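(* Let $n\in\mathbb{N}$ and let $S$ be a set. Then $\mathsf{CC}_n(\mathsf{2}^S)^*$ is the $\mathsf{GA}_n$-algebra free over $S$ via the map $r_n\colon S\to\mathsf{CC}_n(\mathsf{2}^S)^*$, $r_n(s)=\Box U_s\cap\mathsf{CC}_n(\mathsf{2}^S)$, where $U_s=\{(a_i)_{i\in S}\mid a_s=1\}$; that is, for every $\mathsf{GA}_n$-algebra $H$ and function $f\colon S\to H$ there is a unique Heyting homomorphism $g\colon\mathsf{CC}_n(\mathsf{2}^S)^*\to H$ with $g\circ r_n=f$.
   Context: $\mathsf{2}=\{0<1\}$ with discrete topology; $\mathsf{2}^S$ has the product topology and componentwise order (a Priestley space). For a Priestley space $X$, $\mathsf{CC}(X)$ is the set of nonempty closed chains (totally ordered subsets) of $X$ with topology generated by $\Box V=\{C\mid C\subseteq V\}$, $\Diamond V=\{C\mid C\cap V\ne\varnothing\}$ ($V$ clopen in $X$) and order $C_1\unlhd C_2$ iff $C_2\subseteq C_1$ and $C_2$ is an upset of $C_1$. The depth of $C\in\mathsf{CC}(X)$ is the cardinality of $\{K\mid C\unlhd K\}$ (or $\infty$), and $\mathsf{CC}_n(X)$ is the subspace of elements of depth $\le n$ with the induced order. For an Esakia space $Y$, $Y^*$ is the Heyting algebra of its clopen upsets. A Gödel algebra is a Heyting algebra with $(x\to y)\vee(y\to x)=1$; with $\mathsf{bd}_0=0$, $\mathsf{bd}_n=x_n\vee(x_n\to\mathsf{bd}_{n-1})$, $\mathsf{GA}_n$ is the variety of Gödel algebras satisfying $\mathsf{bd}_n=1$.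 *)

theory Defs
  imports "HOL-Analysis.Analysis" "HOL-Algebra.Lattice" "HOL-Library.Extended_Nat"
begin

section \<open>Heyting algebras and Goedel algebras\<close>

text \<open>
  The implication is a record field; in a Heyting algebra residuation determines it on the carrier.
  Meets, joins and bounds are those of the underlying order.
  The qualifier in \<open>Lattice.bounded_lattice\<close> selects the carrier-based locale of HOL-Algebra
  rather than the type class.
\<close>

record 'a heyting = "'a gorder" +
  himp :: "'a \<Rightarrow> 'a \<Rightarrow> 'a" (infixr \<open>\<rightharpoonup>\<index>\<close> 60)

locale heyting_algebra = Lattice.bounded_lattice H for H :: "'a heyting" (structure) +
  assumes himp_closed: "\<lbrakk>x \<in> carrier H; y \<in> carrier H\<rbrakk> \<Longrightarrow> x \<rightharpoonup> y \<in> carrier H"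
    and residuation: "\<lbrakk>x \<in> carrier H; y \<in> carrier H; z \<in> carrier H\<rbrakk>
      \<Longrightarrow> (x \<sqinter> y \<sqsubseteq> z) \<longleftrightarrow> (x \<sqsubseteq> y \<rightharpoonup> z)"

locale goedel_algebra = heyting_algebra +
  assumes prelinear: "\<lbrakk>x \<in> carrier H; y \<in> carrier H\<rbrakk> \<Longrightarrow> (x \<rightharpoonup> y) \<squnion> (y \<rightharpoonup> x) = \<top>"

text \<open>The value of the term $\mathsf{bd}_n$ when each variable $x_i$ is assigned the element \<open>x i\<close>.\<close>

primrec bd :: "'a heyting \<Rightarrow> (nat \<Rightarrow> 'a) \<Rightarrow> nat \<Rightarrow> 'a" where
  "bd H x 0 = \<bottom>\<^bsub>H\<^esub>"
| "bd H x (Suc n) = x (Suc n) \<squnion>\<^bsub>H\<^esub> (x (Suc n) \<rightharpoonup>\<^bsub>H\<^esub> bd H x n)"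

locale GA_algebra = goedel_algebra H for n :: nat and H :: "'a heyting" (structure) +
  assumes bd_top: "(\<And>i. x i \<in> carrier H) \<Longrightarrow> bd H x n = \<top>"

definition heyting_hom :: "'a heyting \<Rightarrow> 'b heyting \<Rightarrow> ('a \<Rightarrow> 'b) set" where
  "heyting_hom A B = {g \<in> carrier A \<rightarrow> carrier B.
     (\<forall>x\<in>carrier A. \<forall>y\<in>carrier A.
        g (x \<sqinter>\<^bsub>A\<^esub> y) = g x \<sqinter>\<^bsub>B\<^esub> g y \<and>
        g (x \<squnion>\<^bsub>A\<^esub> y) = g x \<squnion>\<^bsub>B\<^esub> g y \<and>
        g (x \<rightharpoonup>\<^bsub>A\<^esub> y) = g x \<rightharpoonup>\<^bsub>B\<^esub> g y) \<and>
     g \<bottom>\<^bsub>A\<^esub> = \<bottom>\<^bsub>B\<^esub> \<and> g \<top>\<^bsub>A\<^esub> = \<top>\<^bsub>B\<^esub>}"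


section \<open>Ordered topological spaces\<close>

text \<open>The order \<open>ole\<close> is only meaningful on the underlying set of \<open>otop\<close>.\<close>

record 'a ordered_space =
  otop :: "'a topology"
  ole :: "'a \<Rightarrow> 'a \<Rightarrow> bool"

abbreviation points :: "'a ordered_space \<Rightarrow> 'a set" where
  "points X \<equiv> topspace (otop X)"

definition clopen_in :: "'a topology \<Rightarrow> 'a set \<Rightarrow> bool" where
  "clopen_in T V \<longleftrightarrow> openin T V \<and> closedin T V"

definition upset_of :: "('a \<Rightarrow> 'a \<Rightarrow> bool) \<Rightarrow> 'a set \<Rightarrow> 'a set \<Rightarrow> bool" where
  "upset_of r P U \<longleftrightarrow> U \<subseteq> P \<and> (\<forall>x\<in>U. \<forall>y\<in>P. r x y \<longrightarrow> y \<in> U)"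

definition downclosure :: "('a \<Rightarrow> 'a \<Rightarrow> bool) \<Rightarrow> 'a set \<Rightarrow> 'a set \<Rightarrow> 'a set" where
  "downclosure r P A = {x \<in> P. \<exists>y\<in>A. r x y}"

text \<open>
  The dual algebra $Y^*$ of clopen upsets.  The given operation is the usual implication
  $Y \setminus {\downarrow}(U \setminus V)$.
\<close>

definition clopen_upsets :: "'a ordered_space \<Rightarrow> 'a set heyting" where
  "clopen_upsets Y =
     \<lparr> carrier = {U. clopen_in (otop Y) U \<and> upset_of (ole Y) (points Y) U},
       eq = (=),
       le = (\<subseteq>),
       himp = (\<lambda>U V. points Y - downclosure (ole Y) (points Y) (U - V)) \<rparr>"


section \<open>The space of nonempty closed chains\<close>

definition closed_chains :: "'a ordered_space \<Rightarrow> 'a set set" where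
  "closed_chains X = {C. C \<noteq> {} \<and> closedin (otop X) C \<and> (\<forall>x\<in>C. \<forall>y\<in>C. ole X x y \<or> ole X y x)}"

definition cc_box :: "'a ordered_space \<Rightarrow> 'a set \<Rightarrow> 'a set set" where
  "cc_box X V = {C \<in> closed_chains X. C \<subseteq> V}"

definition cc_diamond :: "'a ordered_space \<Rightarrow> 'a set \<Rightarrow> 'a set set" where
  "cc_diamond X V = {C \<in> closed_chains X. C \<inter> V \<noteq> {}}"

definition CC :: "'a ordered_space \<Rightarrow> 'a set ordered_space" where
  "CC X =
     \<lparr> otop = topology_generated_by
         ({cc_box X V | V. clopen_in (otop X) V} \<union> {cc_diamond X V | V. clopen_in (otop X) V}),
       ole = (\<lambda>C1 C2. C2 \<subseteq> C1 \<and> upset_of (ole X) C1 C2) \<rparr>"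

lemma points_CC: "points (CC X) = closed_chains X"
proof
  show "points (CC X) \<subseteq> closed_chains X"
    unfolding CC_def cc_box_def cc_diamond_def by auto
  have "closed_chains X = cc_box X (points X)"
    unfolding cc_box_def closed_chains_def using closedin_subset by blast
  moreover have "clopen_in (otop X) (points X)"
    by (simp add: clopen_in_def)
  ultimately have "closed_chains X \<in> {cc_box X V | V. clopen_in (otop X) V}"
    by blast
  then show "closed_chains X \<subseteq> points (CC X)"
    unfolding CC_def ordered_space.simps topology_generated_by_topspace by blast
qed

definition depth :: "'a ordered_space \<Rightarrow> 'a set \<Rightarrow> enat" where
  "depth X C =
     (let Ks = {K \<in> closed_chains X. ole (CC X) C K}
      in if finite Ks then enat (card Ks) else \<infinity>)"

definition CC_n :: "nat \<Rightarrow> 'a ordered_space \<Rightarrow> 'a set ordered_space" where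
  "CC_n n X =
     \<lparr> otop = subtopology (otop (CC X)) {C \<in> closed_chains X. depth X C \<le> enat n},
       ole = ole (CC X) \<rparr>"


section \<open>The power of the two-element chain\<close>

text \<open>
  The two-element chain is the type \<^typ>\<open>bool\<close> with $\mathsf{False} < \mathsf{True}$.  The points
  of the product topology are the functions that are \<open>undefined\<close> outside \<open>S\<close>, i.e.
  \<open>S \<rightarrow>\<^sub>E UNIV\<close>.
\<close>

definition two_pow :: "'i set \<Rightarrow> ('i \<Rightarrow> bool) ordered_space" where
  "two_pow S =
     \<lparr> otop = product_topology (\<lambda>_. discrete_topology UNIV) S,
       ole = (\<lambda>a b. \<forall>i\<in>S. a i \<le> b i) \<rparr>"

definition U_coord :: "'i set \<Rightarrow> 'i \<Rightarrow> ('i \<Rightarrow> bool) set" where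
  "U_coord S s = {a \<in> points (two_pow S). a s = True}"

definition gen_map :: "nat \<Rightarrow> 'i set \<Rightarrow> 'i \<Rightarrow> ('i \<Rightarrow> bool) set set" where
  "gen_map n S s = cc_box (two_pow S) (U_coord S s) \<inter> points (CC_n n (two_pow S))"

end

theory Submission
  imports Defs
begin

text \<open>
  The points of \<open>CC_n n (two_pow S)\<close> are the nonempty chains in the cube with at most \<open>n\<close> elements,
  ordered by passing to a final part.

  The clopen upsets are exactly the sets generated from the \<open>\<box>U_s\<close> by the Heyting operations.
  Membership of a chain in a generated set depends only on finitely many coordinates, so
  generated sets are clopen. Conversely, if \<open>K\<close> is not a final part of \<open>C\<close>, then an explicit
  Heyting term of implications separates them. The space is compact, being a continuous image of
  \<open>{0..n}^S\<close>, so every clopen upset is a finite union of finite intersections of generated sets.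
  This gives uniqueness.

  For existence, let \<open>f\<close> assign elements of a \<open>GA_n\<close>-algebra to \<open>S\<close>. The prime filters above a
  prime filter \<open>p\<close> form a chain of at most \<open>n\<close> elements, whose traces on \<open>S\<close> form a point of the
  space. This map from prime filters to chains is a p-morphism, so by induction on generation the
  preimage of every clopen upset has the form \<open>{p. h \<in> p}\<close> for some \<open>h\<close>, and \<open>h\<close> is unique
  by the prime filter theorem.
\<close>

section \<open>Prime filters of Goedel algebras\<close>

definition lattice_filter :: "'a heyting \<Rightarrow> 'a set \<Rightarrow> bool" where
  "lattice_filter H p \<longleftrightarrow> p \<subseteq> carrier H \<and> \<top>\<^bsub>H\<^esub> \<in> p \<and>
     (\<forall>x\<in>p. \<forall>y\<in>p. x \<sqinter>\<^bsub>H\<^esub> y \<in> p) \<and>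
     (\<forall>x\<in>p. \<forall>y\<in>carrier H. x \<sqsubseteq>\<^bsub>H\<^esub> y \<longrightarrow> y \<in> p)"

definition prime_filter :: "'a heyting \<Rightarrow> 'a set \<Rightarrow> bool" where
  "prime_filter H p \<longleftrightarrow> lattice_filter H p \<and> \<bottom>\<^bsub>H\<^esub> \<notin> p \<and>
     (\<forall>x\<in>carrier H. \<forall>y\<in>carrier H. x \<squnion>\<^bsub>H\<^esub> y \<in> p \<longrightarrow> x \<in> p \<or> y \<in> p)"

definition primes_above :: "'a heyting \<Rightarrow> 'a set \<Rightarrow> 'a set set" where
  "primes_above H p = {q. prime_filter H q \<and> p \<subseteq> q}"

lemma prime_filter_imp_filter: "prime_filter H p \<Longrightarrow> lattice_filter H p"
  by (simp add: prime_filter_def)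

context heyting_algebra
begin

lemma filter_carrier: "lattice_filter H p \<Longrightarrow> x \<in> p \<Longrightarrow> x \<in> carrier H"
  by (auto simp: lattice_filter_def)

lemma filter_up: "\<lbrakk>lattice_filter H p; x \<in> p; y \<in> carrier H; x \<sqsubseteq> y\<rbrakk> \<Longrightarrow> y \<in> p"
  by (auto simp: lattice_filter_def)

lemma filter_meet_iff:
  assumes "lattice_filter H p" "x \<in> carrier H" "y \<in> carrier H"
  shows "x \<sqinter> y \<in> p \<longleftrightarrow> x \<in> p \<and> y \<in> p"
proof
  assume m: "x \<sqinter> y \<in> p"
  show "x \<in> p \<and> y \<in> p"
    using filter_up[OF assms(1) m] assms(2,3) meet_left meet_right by blast
qed (use assms(1) in \<open>simp add: lattice_filter_def\<close>)

lemma prime_join_iff: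
  assumes "prime_filter H p" "x \<in> carrier H" "y \<in> carrier H"
  shows "x \<squnion> y \<in> p \<longleftrightarrow> x \<in> p \<or> y \<in> p"
proof
  assume "x \<in> p \<or> y \<in> p"
  then show "x \<squnion> y \<in> p"
    using filter_up[OF prime_filter_imp_filter[OF assms(1)] _ join_closed[OF assms(2,3)]]
      join_left[OF assms(2,3)] join_right[OF assms(2,3)] by blast
qed (use assms in \<open>simp add: prime_filter_def\<close>)

lemma himp_leI:
  "\<lbrakk>x \<sqinter> y \<sqsubseteq> z; x \<in> carrier H; y \<in> carrier H; z \<in> carrier H\<rbrakk> \<Longrightarrow> x \<sqsubseteq> y \<rightharpoonup> z"
  by (simp add: residuation)

lemma himp_leD:
  "\<lbrakk>x \<sqsubseteq> y \<rightharpoonup> z; x \<in> carrier H; y \<in> carrier H; z \<in> carrier H\<rbrakk> \<Longrightarrow> x \<sqinter> y \<sqsubseteq> z"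
  by (simp add: residuation)

lemma modus_ponens_le:
  assumes "x \<in> carrier H" "y \<in> carrier H"
  shows "(x \<rightharpoonup> y) \<sqinter> x \<sqsubseteq> y"
  using assms by (intro himp_leD) (auto simp: himp_closed)

lemma filter_modus_ponens:
  assumes p: "lattice_filter H p" and xy: "x \<rightharpoonup> y \<in> p" and x: "x \<in> p" and y: "y \<in> carrier H"
  shows "y \<in> p"
proof -
  have "(x \<rightharpoonup> y) \<sqinter> x \<in> p" using p xy x by (simp add: lattice_filter_def)
  then show ?thesis
    by (rule filter_up[OF p _ y modus_ponens_le[OF filter_carrier[OF p x] y]])
qed

lemma filter_himp_weaken:
  assumes p: "lattice_filter H p" and zp: "z \<in> p" and h: "h \<in> carrier H"
  shows "h \<rightharpoonup> z \<in> p"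
proof -
  have z: "z \<in> carrier H" using p zp by (rule filter_carrier)
  show ?thesis
    by (rule filter_up[OF p zp himp_closed[OF h z] himp_leI[OF meet_left[OF z h] z h z]])
qed

lemma filter_himp_self:
  assumes p: "lattice_filter H p" and h: "h \<in> carrier H"
  shows "h \<rightharpoonup> h \<in> p"
proof -
  have "\<top> \<in> p" using p by (simp add: lattice_filter_def)
  then show ?thesis
    by (rule filter_up[OF p _ himp_closed[OF h h]
          himp_leI[OF meet_right[OF top_closed h] top_closed h h]])
qed

text \<open>By residuation \<open>h \<rightharpoonup> z \<in> p\<close> says that some
  \<open>m \<in> p\<close> has \<open>m \<sqinter> h \<sqsubseteq> z\<close>, so this set is the
  filter generated by \<open>p\<close> and \<open>h\<close>, described without an existential
  quantifier.\<close>

lemma filter_adjoin: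
  assumes p: "lattice_filter H p" and h: "h \<in> carrier H"
  shows "lattice_filter H {z \<in> carrier H. h \<rightharpoonup> z \<in> p}"
proof -
  have meet: "h \<rightharpoonup> (x \<sqinter> y) \<in> p"
    if x: "x \<in> carrier H" "h \<rightharpoonup> x \<in> p" and y: "y \<in> carrier H" "h \<rightharpoonup> y \<in> p" for x y
  proof -
    let ?m = "(h \<rightharpoonup> x) \<sqinter> (h \<rightharpoonup> y)"
    have c: "h \<rightharpoonup> x \<in> carrier H" "h \<rightharpoonup> y \<in> carrier H" using himp_closed h x y by auto
    have m: "?m \<in> carrier H" using c by simp
    have mp: "?m \<in> p" using filter_meet_iff[OF p c] x y by simp
    have "?m \<sqinter> h \<sqsubseteq> x" "?m \<sqinter> h \<sqsubseteq> y"
      using himp_leD[OF meet_left[OF c] m h x(1)] himp_leD[OF meet_right[OF c] m h y(1)] by auto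
    then have "?m \<sqinter> h \<sqsubseteq> x \<sqinter> y" using m h x(1) y(1) by (intro meet_le) auto
    then have "?m \<sqsubseteq> h \<rightharpoonup> (x \<sqinter> y)" using m h x(1) y(1) by (intro himp_leI) auto
    then show ?thesis by (rule filter_up[OF p mp himp_closed[OF h meet_closed[OF x(1) y(1)]]])
  qed
  have up: "h \<rightharpoonup> y \<in> p"
    if x: "x \<in> carrier H" "h \<rightharpoonup> x \<in> p" and y: "y \<in> carrier H" and le: "x \<sqsubseteq> y" for x y
  proof -
    have c: "h \<rightharpoonup> x \<in> carrier H" using himp_closed h x by auto
    have "(h \<rightharpoonup> x) \<sqinter> h \<sqsubseteq> y"
      by (rule le_trans[OF modus_ponens_le[OF h x(1)] le meet_closed[OF c h] x(1) y])
    then have "h \<rightharpoonup> x \<sqsubseteq> h \<rightharpoonup> y" using c h y by (rule himp_leI)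
    then show ?thesis by (rule filter_up[OF p x(2) himp_closed[OF h y]])
  qed
  have "h \<rightharpoonup> \<top> \<in> p"
    using filter_himp_weaken[OF p _ h] p by (simp add: lattice_filter_def)
  then show ?thesis
    unfolding lattice_filter_def by (simp add: meet up) (blast intro: up)
qed

text \<open>Meeting with \<open>z\<close> is left adjoint to implication from \<open>z\<close>,
  hence preserves joins. This distributivity is what makes maximal filters prime.\<close>

lemma join_meet_le:
  assumes c: "x \<in> carrier H" "y \<in> carrier H" "z \<in> carrier H" "k \<in> carrier H"
    and le: "z \<sqinter> x \<sqsubseteq> k" "z \<sqinter> y \<sqsubseteq> k"
  shows "z \<sqinter> (x \<squnion> y) \<sqsubseteq> k"
proof -
  have "x \<sqsubseteq> z \<rightharpoonup> k" "y \<sqsubseteq> z \<rightharpoonup> k"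
    using le c by (auto intro!: himp_leI simp: meet_comm[of H _ z])
  then have "x \<squnion> y \<sqsubseteq> z \<rightharpoonup> k" using c himp_closed by (intro join_le) auto
  then have "(x \<squnion> y) \<sqinter> z \<sqsubseteq> k" using c by (intro himp_leD) auto
  then show ?thesis by (simp add: meet_comm[of H z])
qed

text \<open>Zorn's lemma yields a filter \<open>p\<close> maximal among those that contain
  \<open>F\<close> and avoid \<open>k\<close>. Maximality puts \<open>x \<rightharpoonup> k\<close>
  into \<open>p\<close> for every \<open>x\<close> outside \<open>p\<close>; if
  \<open>x \<squnion> y\<close> were in \<open>p\<close> with both \<open>x\<close> and
  \<open>y\<close> outside, distributivity would put \<open>k\<close> into \<open>p\<close>.\<close>

theorem prime_filter_exists:
  assumes F: "lattice_filter H F" and k: "k \<in> carrier H" "k \<notin> F"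
  obtains p where "prime_filter H p" "F \<subseteq> p" "k \<notin> p"
proof -
  define A where "A = {p. lattice_filter H p \<and> F \<subseteq> p \<and> k \<notin> p}"
  have FA: "F \<in> A" using assms by (simp add: A_def)
  have "\<exists>M\<in>A. \<forall>X\<in>A. M \<subseteq> X \<longrightarrow> X = M"
  proof (rule subset_Zorn)
    fix C assume C: "subset.chain A C"
    show "\<exists>U\<in>A. \<forall>X\<in>C. X \<subseteq> U"
    proof (cases "C = {}")
      \<comment> \<open>The union of the empty chain is not a filter, so \<open>F\<close> itself
        serves as the bound.\<close>
      case True then show ?thesis using FA by blast
    next
      case False
      have CA: "\<And>X. X \<in> C \<Longrightarrow> lattice_filter H X \<and> F \<subseteq> X \<and> k \<notin> X"
        using C by (auto simp: subset.chain_def A_def)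
      have tot: "\<And>X Y. X \<in> C \<Longrightarrow> Y \<in> C \<Longrightarrow> X \<subseteq> Y \<or> Y \<subseteq> X"
        using C by (auto simp: subset.chain_def)
      have "x \<sqinter> y \<in> \<Union>C" if xy: "x \<in> \<Union>C" "y \<in> \<Union>C" for x y
      proof -
        obtain X Y where XY: "X \<in> C" "x \<in> X" "Y \<in> C" "y \<in> Y" using xy by blast
        then obtain Z where "Z \<in> C" "x \<in> Z" "y \<in> Z" using tot by blast
        then show ?thesis using CA unfolding lattice_filter_def by blast
      qed
      moreover have "y \<in> \<Union>C" if "x \<in> \<Union>C" "y \<in> carrier H" "x \<sqsubseteq> y" for x y
        using that CA filter_up by blast
      moreover have "\<top> \<in> \<Union>C" "\<Union>C \<subseteq> carrier H"
        using CA False unfolding lattice_filter_def by blast+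
      ultimately have "lattice_filter H (\<Union>C)" unfolding lattice_filter_def by blast
      then have "\<Union>C \<in> A" using CA False by (auto simp: A_def)
      then show ?thesis by blast
    qed
  qed
  then obtain p where pA: "p \<in> A" and max: "\<And>X. X \<in> A \<Longrightarrow> p \<subseteq> X \<Longrightarrow> X = p" by blast
  have p: "lattice_filter H p" "F \<subseteq> p" "k \<notin> p" using pA by (auto simp: A_def)
  have adj: "x \<rightharpoonup> k \<in> p" if x: "x \<in> carrier H" "x \<notin> p" for x
  proof (rule ccontr)
    assume neg: "x \<rightharpoonup> k \<notin> p"
    \<comment> \<open>The filter generated by \<open>p\<close> and \<open>x\<close>: it avoids
      \<open>k\<close> by \<open>neg\<close>, yet properly extends \<open>p\<close>.\<close>
    let ?q = "{z \<in> carrier H. x \<rightharpoonup> z \<in> p}"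
    have sub: "p \<subseteq> ?q" using filter_himp_weaken[OF p(1)] filter_carrier[OF p(1)] x by blast
    then have "?q \<in> A" using filter_adjoin[OF p(1) x(1)] neg p by (auto simp: A_def)
    then have "?q = p" using max sub by blast
    moreover have "x \<in> ?q" using filter_himp_self[OF p(1) x(1)] x by simp
    ultimately show False using x by blast
  qed
  have "prime_filter H p"
    unfolding prime_filter_def
  proof (intro conjI ballI impI)
    show "lattice_filter H p" by (rule p)
    show "\<bottom> \<notin> p" using filter_up[OF p(1) _ k(1)] p(3) bottom_lower[OF k(1)] by blast
    fix x y assume xy: "x \<in> carrier H" "y \<in> carrier H" "x \<squnion> y \<in> p"
    show "x \<in> p \<or> y \<in> p"
    proof (rule ccontr)
      assume "\<not> (x \<in> p \<or> y \<in> p)"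
      then have i: "x \<rightharpoonup> k \<in> p" "y \<rightharpoonup> k \<in> p" using adj xy by auto
      have c: "x \<rightharpoonup> k \<in> carrier H" "y \<rightharpoonup> k \<in> carrier H" using himp_closed xy k by auto
      let ?m = "(x \<rightharpoonup> k) \<sqinter> (y \<rightharpoonup> k)"
      have m: "?m \<in> carrier H" "?m \<in> p" using c i filter_meet_iff[OF p(1) c] by auto
      have "?m \<sqinter> (x \<squnion> y) \<sqsubseteq> k"
        by (rule join_meet_le[OF xy(1,2) m(1) k(1) himp_leD[OF meet_left[OF c] m(1) xy(1) k(1)]
              himp_leD[OF meet_right[OF c] m(1) xy(2) k(1)]])
      moreover have "?m \<sqinter> (x \<squnion> y) \<in> p" using m xy filter_meet_iff[OF p(1) m(1)] by simp
      ultimately show False using filter_up[OF p(1) _ k(1)] p(3) by blast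
    qed
  qed
  then show ?thesis using that p by blast
qed

text \<open>If \<open>h\<close> is not below \<open>k\<close>, the principal filter of
  \<open>h\<close> avoids \<open>k\<close>, and hence so does some prime filter containing
  \<open>h\<close>.\<close>

lemma le_if_primes:
  assumes "h \<in> carrier H" "k \<in> carrier H"
    and "\<And>p. prime_filter H p \<Longrightarrow> h \<in> p \<Longrightarrow> k \<in> p"
  shows "h \<sqsubseteq> k"
proof (rule ccontr)
  assume neg: "\<not> h \<sqsubseteq> k"
  let ?F = "{z \<in> carrier H. h \<sqsubseteq> z}"
  have "lattice_filter H ?F"
    unfolding lattice_filter_def using assms(1,2) by (auto intro: meet_le le_trans)
  then obtain p where "prime_filter H p" "?F \<subseteq> p" "k \<notin> p"
    using prime_filter_exists[of ?F k] neg assms(2) by blast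
  moreover have "h \<in> ?F" using assms by simp
  ultimately show False using assms(3) by blast
qed

lemma eq_if_primes:
  assumes "h \<in> carrier H" "k \<in> carrier H"
    and "\<And>p. prime_filter H p \<Longrightarrow> h \<in> p \<longleftrightarrow> k \<in> p"
  shows "h = k"
  using assms le_if_primes[of h k] le_if_primes[of k h] le_antisym by blast

text \<open>This is the Kripke clause for implication. If \<open>h \<rightharpoonup> k\<close> is
  missing from \<open>p\<close>, the filter generated by \<open>p\<close> and \<open>h\<close>
  avoids \<open>k\<close>, and a prime extension avoiding \<open>k\<close> is a counterexample on
  the right.\<close>

lemma prime_himp_iff:
  assumes p: "prime_filter H p" and c: "h \<in> carrier H" "k \<in> carrier H"
  shows "h \<rightharpoonup> k \<in> p \<longleftrightarrow> (\<forall>q\<in>primes_above H p. h \<in> q \<longrightarrow> k \<in> q)"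
proof
  assume "h \<rightharpoonup> k \<in> p"
  then show "\<forall>q\<in>primes_above H p. h \<in> q \<longrightarrow> k \<in> q"
    using filter_modus_ponens c prime_filter_imp_filter unfolding primes_above_def by blast
next
  assume R: "\<forall>q\<in>primes_above H p. h \<in> q \<longrightarrow> k \<in> q"
  have pf: "lattice_filter H p" using p by (rule prime_filter_imp_filter)
  let ?F = "{z \<in> carrier H. h \<rightharpoonup> z \<in> p}"
  show "h \<rightharpoonup> k \<in> p"
  proof (rule ccontr)
    assume "h \<rightharpoonup> k \<notin> p"
    then obtain q where q: "prime_filter H q" "?F \<subseteq> q" "k \<notin> q"
      using prime_filter_exists[OF filter_adjoin[OF pf c(1)] c(2)] by blast
    have "p \<subseteq> ?F" using filter_himp_weaken[OF pf] filter_carrier[OF pf] c by blast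
    moreover have "h \<in> ?F" using filter_himp_self[OF pf c(1)] c by simp
    ultimately have "q \<in> primes_above H p" "h \<in> q" using q by (auto simp: primes_above_def)
    then show False using R q(3) by blast
  qed
qed

lemma bd_closed: "(\<And>i. x i \<in> carrier H) \<Longrightarrow> bd H x n \<in> carrier H"
  by (induction n) (auto simp: himp_closed)

end

text \<open>Allows the variable \<open>Suc k\<close> to be reassigned without disturbing the value
  at stage \<open>k\<close>.\<close>

lemma bd_cong: "(\<And>i. i \<le> n \<Longrightarrow> x i = y i) \<Longrightarrow> bd H x n = bd H y n"
  by (induction n) auto

context goedel_algebra
begin

text \<open>Prelinearity puts \<open>x \<rightharpoonup> y\<close> or
  \<open>y \<rightharpoonup> x\<close> into \<open>p\<close>. With \<open>x\<close> only in
  \<open>q\<close> and \<open>y\<close> only in \<open>r\<close>, modus ponens inside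
  \<open>q\<close> or inside \<open>r\<close> gives a contradiction.\<close>

lemma primes_above_chain:
  assumes p: "prime_filter H p" and q: "q \<in> primes_above H p" and r: "r \<in> primes_above H p"
  shows "q \<subseteq> r \<or> r \<subseteq> q"
proof (rule ccontr)
  assume "\<not> (q \<subseteq> r \<or> r \<subseteq> q)"
  then obtain x y where xy: "x \<in> q" "x \<notin> r" "y \<in> r" "y \<notin> q" by blast
  have f: "lattice_filter H p" "lattice_filter H q" "lattice_filter H r" "p \<subseteq> q" "p \<subseteq> r"
    using p q r by (auto simp: primes_above_def prime_filter_def)
  have c: "x \<in> carrier H" "y \<in> carrier H" using xy f filter_carrier by blast+
  have "(x \<rightharpoonup> y) \<squnion> (y \<rightharpoonup> x) \<in> p" using prelinear c f by (simp add: lattice_filter_def)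
  then have "x \<rightharpoonup> y \<in> p \<or> y \<rightharpoonup> x \<in> p" using prime_join_iff[OF p] himp_closed c by simp
  then show False using filter_modus_ponens[OF f(2)] filter_modus_ponens[OF f(3)] xy f c by blast
qed

text \<open>Drop \<open>p\<close> from the family and let \<open>q\<close> be the least of
  \<open>Suc k\<close> remaining filters. By induction an assignment refutes stage \<open>k\<close>
  in \<open>q\<close>, and giving the variable \<open>Suc k\<close> a value in \<open>q - p\<close>
  refutes the next stage in \<open>p\<close>. One filter more than the stage is asked for because
  stage 0 is \<open>\<bottom>\<close>, which already a single prime filter omits.\<close>

lemma bd_notin_prime:
  "\<lbrakk>prime_filter H p; A \<subseteq> primes_above H p; finite A; card A = Suc k\<rbrakk>
    \<Longrightarrow> \<exists>x. (\<forall>i. x i \<in> carrier H) \<and> bd H x k \<notin> p"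
proof (induction k arbitrary: p A)
  case 0
  have "\<forall>i::nat. \<bottom> \<in> carrier H" by simp
  then show ?case using 0 by (intro exI[of _ "\<lambda>_. \<bottom>"]) (simp add: prime_filter_def)
next
  case (Suc k)
  \<comment> \<open>\<open>p\<close> may or may not belong to \<open>A\<close>; removing it costs at
    most one element.\<close>
  have "Suc k \<le> card (A - {p})" using Suc.prems by (cases "p \<in> A") auto
  then obtain B where B: "B \<subseteq> A - {p}" "card B = Suc k" "finite B"
    by (rule obtain_subset_with_card_n)
  then have "B \<noteq> {}" by auto
  then obtain q where q: "q \<in> B" and qmin: "\<forall>r\<in>B. r \<subseteq> q \<longrightarrow> q = r"
    using finite_has_minimal[OF B(3)] by blast
  have q': "prime_filter H q" "p \<subseteq> q" "q \<noteq> p" "q \<in> primes_above H p"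
    using q B Suc.prems unfolding primes_above_def by blast+
  have "B \<subseteq> primes_above H q"
  proof
    fix r assume r: "r \<in> B"
    then have "r \<in> primes_above H p" using B Suc.prems by blast
    then have "q \<subseteq> r \<or> r \<subseteq> q" using primes_above_chain[OF Suc.prems(1) q'(4)] by blast
    then have "q \<subseteq> r" using qmin r by blast
    then show "r \<in> primes_above H q" using \<open>r \<in> primes_above H p\<close> by (simp add: primes_above_def)
  qed
  then obtain x where x: "\<forall>i. x i \<in> carrier H" "bd H x k \<notin> q"
    using Suc.IH[OF q'(1)] B by blast
  obtain y where y: "y \<in> q" "y \<notin> p" using q' by blast
  have yc: "y \<in> carrier H" using y filter_carrier prime_filter_imp_filter[OF q'(1)] by blast
  \<comment> \<open>\<open>y\<close> lies outside \<open>p\<close>, and so does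
    \<open>y \<rightharpoonup> bd H x k\<close>, which would force \<open>bd H x k\<close> into
    \<open>q\<close> by modus ponens.\<close>
  let ?x = "x(Suc k := y)"
  have eq: "bd H ?x k = bd H x k" by (rule bd_cong) auto
  have c: "bd H x k \<in> carrier H" using bd_closed x by blast
  have "y \<rightharpoonup> bd H x k \<notin> p"
    using filter_modus_ponens[OF prime_filter_imp_filter[OF q'(1)] _ y(1) c] x q' by blast
  then have "bd H ?x (Suc k) \<notin> p"
    using y prime_join_iff[OF Suc.prems(1) yc himp_closed[OF yc c]] by (simp add: eq)
  moreover have "\<forall>i. ?x i \<in> carrier H" using x yc by simp
  ultimately show ?case by blast
qed

end

lemma (in GA_algebra) primes_above_card:
  assumes p: "prime_filter H p"
  shows "finite (primes_above H p) \<and> card (primes_above H p) \<le> n"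
proof (rule ccontr)
  assume "\<not> ?thesis"
  then have "\<exists>A. A \<subseteq> primes_above H p \<and> finite A \<and> card A = Suc n"
  proof (cases "finite (primes_above H p)")
    case True
    then have "Suc n \<le> card (primes_above H p)"
      using \<open>\<not> (finite (primes_above H p) \<and> card (primes_above H p) \<le> n)\<close> by simp
    then show ?thesis by (metis obtain_subset_with_card_n)
  next
    case False
    then show ?thesis using infinite_arbitrarily_large by blast
  qed
  then obtain x where x: "\<forall>i. x i \<in> carrier H" "bd H x n \<notin> p"
    using bd_notin_prime[OF p] by blast
  then show False using bd_top[of x] p by (simp add: prime_filter_def lattice_filter_def)
qed

section \<open>Chains in the cube\<close>

text \<open>The order of \<open>CC\<close> written with the pointwise order of functions. It agrees
  with the order of \<open>two_pow S\<close> on points, since these are all \<open>undefined\<close>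
  outside \<open>S\<close>.\<close>

definition final_part :: "'a::order set \<Rightarrow> 'a set \<Rightarrow> bool" where
  "final_part C K \<longleftrightarrow> K \<subseteq> C \<and> (\<forall>x\<in>K. \<forall>y\<in>C. x \<le> y \<longrightarrow> y \<in> K)"

text \<open>Depth at most \<open>n\<close> becomes a bound on cardinality, and closedness is then
  automatic, finite subsets of a Hausdorff space being closed.\<close>

definition cube_chains :: "nat \<Rightarrow> 'i set \<Rightarrow> ('i \<Rightarrow> bool) set set" where
  "cube_chains n S = {C. C \<noteq> {} \<and> finite C \<and> card C \<le> n \<and> C \<subseteq> S \<rightarrow>\<^sub>E UNIV \<and>
     (\<forall>x\<in>C. \<forall>y\<in>C. x \<le> y \<or> y \<le> x)}"

lemma final_part_refl: "final_part C C"
  by (auto simp: final_part_def)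

lemma final_partD1: "final_part C K \<Longrightarrow> K \<subseteq> C"
  by (simp add: final_part_def)

lemma final_partD2: "\<lbrakk>final_part C K; x \<in> K; y \<in> C; x \<le> y\<rbrakk> \<Longrightarrow> y \<in> K"
  unfolding final_part_def by metis

lemma final_partI:
  "\<lbrakk>K \<subseteq> C; \<And>x y. \<lbrakk>x \<in> K; y \<in> C; x \<le> y\<rbrakk> \<Longrightarrow> y \<in> K\<rbrakk> \<Longrightarrow> final_part C K"
  unfolding final_part_def by metis

lemma final_part_trans:
  assumes "final_part C K" "final_part K L"
  shows "final_part C L"
proof (rule final_partI)
  show "L \<subseteq> C" using assms final_partD1 by blast
  fix x y assume xy: "x \<in> L" "y \<in> C" "x \<le> y"
  then have "x \<in> K" using final_partD1[OF assms(2)] by blast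
  then have "y \<in> K" using final_partD2[OF assms(1)] xy by blast
  then show "y \<in> L" using final_partD2[OF assms(2)] xy by blast
qed

lemma final_part_above: "final_part C {x \<in> C. d \<le> x}"
  by (auto simp: final_part_def)

lemma cube_chain_total: "\<lbrakk>C \<in> cube_chains n S; x \<in> C; y \<in> C\<rbrakk> \<Longrightarrow> x \<le> y \<or> y \<le> x"
  unfolding cube_chains_def by blast

lemma cube_chainsD:
  assumes "C \<in> cube_chains n S"
  shows "C \<noteq> {}" "finite C" "card C \<le> n" "C \<subseteq> S \<rightarrow>\<^sub>E UNIV"
  using assms by (simp_all add: cube_chains_def)

lemma cube_chains_subset:
  assumes C: "C \<in> cube_chains n S" and K: "K \<subseteq> C" "K \<noteq> {}"
  shows "K \<in> cube_chains n S"
proof -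
  have "card K \<le> n" "finite K" "K \<subseteq> S \<rightarrow>\<^sub>E UNIV"
    using cube_chainsD[OF C] K card_mono[of C K] finite_subset[of K C] by auto
  moreover have "x \<le> y \<or> y \<le> x" if "x \<in> K" "y \<in> K" for x y
    using that K by (intro cube_chain_total[OF C]) auto
  ultimately show ?thesis using K by (simp add: cube_chains_def)
qed

lemma cube_chains_final:
  "\<lbrakk>C \<in> cube_chains n S; final_part C K; K \<noteq> {}\<rbrakk> \<Longrightarrow> K \<in> cube_chains n S"
  by (rule cube_chains_subset[OF _ final_partD1])

lemma cube_chains_above:
  "\<lbrakk>C \<in> cube_chains n S; d \<in> C\<rbrakk> \<Longrightarrow> {x \<in> C. d \<le> x} \<in> cube_chains n S"
  by (rule cube_chains_final[OF _ final_part_above]) auto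

lemma cube_not_le:
  assumes "a \<in> S \<rightarrow>\<^sub>E (UNIV :: bool set)" "b \<in> S \<rightarrow>\<^sub>E UNIV" "\<not> a \<le> b"
  obtains s where "s \<in> S" "a s" "\<not> b s"
proof -
  obtain s where s: "a s" "\<not> b s" using assms(3) by (auto simp: le_fun_def)
  \<comment> \<open>Outside \<open>S\<close> both functions have the same value
    \<open>undefined\<close>.\<close>
  moreover have "s \<in> S" using s PiE_arb[OF assms(1)] PiE_arb[OF assms(2)] by metis
  ultimately show ?thesis using that by blast
qed

section \<open>Translation of the general definitions to the cube\<close>

lemma points_two_pow: "points (two_pow S) = S \<rightarrow>\<^sub>E UNIV"
  by (simp add: two_pow_def)

lemma ole_two_pow:
  assumes "a \<in> S \<rightarrow>\<^sub>E UNIV" "b \<in> S \<rightarrow>\<^sub>E UNIV"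
  shows "ole (two_pow S) a b \<longleftrightarrow> a \<le> b"
  using cube_not_le[OF assms] by (auto simp: two_pow_def le_fun_def)

lemma closedin_two_pow_finite:
  assumes "finite C" "C \<subseteq> S \<rightarrow>\<^sub>E UNIV"
  shows "closedin (otop (two_pow S)) C"
proof -
  have "Hausdorff_space (otop (two_pow S))"
    by (simp add: two_pow_def Hausdorff_space_product_topology)
  then show ?thesis
    using assms by (intro closedin_Hausdorff_finite) (auto simp: points_two_pow)
qed

lemma closedin_two_pow_above:
  assumes "c \<in> S \<rightarrow>\<^sub>E UNIV"
  shows "closedin (otop (two_pow S)) {x \<in> S \<rightarrow>\<^sub>E UNIV. c \<le> x}"
proof -
  have "{x \<in> S \<rightarrow>\<^sub>E UNIV. c \<le> x} = (\<Pi>\<^sub>E i\<in>S. {b. c i \<le> b})"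
  proof (rule Set.set_eqI)
    fix x :: "'a \<Rightarrow> bool"
    have "x \<in> S \<rightarrow>\<^sub>E UNIV \<Longrightarrow> c \<le> x \<longleftrightarrow> (\<forall>i\<in>S. c i \<le> x i)"
      using ole_two_pow[OF assms, of x] by (simp add: two_pow_def)
    then show "x \<in> {x \<in> S \<rightarrow>\<^sub>E UNIV. c \<le> x} \<longleftrightarrow> x \<in> (\<Pi>\<^sub>E i\<in>S. {b. c i \<le> b})"
      by (auto simp: PiE_iff)
  qed
  then show ?thesis by (simp add: two_pow_def closedin_product_topology)
qed

lemma closed_chains_two_pow:
  "C \<in> closed_chains (two_pow S) \<longleftrightarrow> C \<noteq> {} \<and> closedin (otop (two_pow S)) C \<and>
     (\<forall>x\<in>C. \<forall>y\<in>C. x \<le> y \<or> y \<le> x)"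
proof -
  have "(\<forall>x\<in>C. \<forall>y\<in>C. ole (two_pow S) x y \<or> ole (two_pow S) y x) \<longleftrightarrow>
      (\<forall>x\<in>C. \<forall>y\<in>C. x \<le> y \<or> y \<le> x)" if "closedin (otop (two_pow S)) C"
  proof (intro ball_cong refl)
    fix x y assume "x \<in> C" "y \<in> C"
    then have "x \<in> S \<rightarrow>\<^sub>E UNIV" "y \<in> S \<rightarrow>\<^sub>E UNIV"
      using subsetD[OF closedin_subset[OF that]] by (simp_all only: points_two_pow)
    then show "(ole (two_pow S) x y \<or> ole (two_pow S) y x) = (x \<le> y \<or> y \<le> x)"
      by (simp add: ole_two_pow)
  qed
  then show ?thesis
    unfolding closed_chains_def by blast
qed

lemma ole_CC_two_pow:
  assumes "C \<subseteq> S \<rightarrow>\<^sub>E UNIV"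
  shows "ole (CC (two_pow S)) C K \<longleftrightarrow> final_part C K"
proof -
  have "(\<forall>x\<in>K. \<forall>y\<in>C. ole (two_pow S) x y \<longrightarrow> y \<in> K) \<longleftrightarrow> (\<forall>x\<in>K. \<forall>y\<in>C. x \<le> y \<longrightarrow> y \<in> K)"
    if "K \<subseteq> C"
  proof (intro ball_cong refl)
    fix x y assume "x \<in> K" "y \<in> C"
    then have "x \<in> S \<rightarrow>\<^sub>E UNIV" "y \<in> S \<rightarrow>\<^sub>E UNIV"
      using that assms by blast+
    then show "(ole (two_pow S) x y \<longrightarrow> y \<in> K) = (x \<le> y \<longrightarrow> y \<in> K)"
      by (simp add: ole_two_pow)
  qed
  then show ?thesis
    by (cases "K \<subseteq> C") (simp_all only: CC_def upset_of_def final_part_def ordered_space.simps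
        if_True simp_thms)
qed

text \<open>The map \<open>up\<close> embeds \<open>C\<close> into the elements above
  \<open>C\<close>, so an infinite chain has infinite depth. If \<open>C\<close> is finite, every
  nonempty final part has a least element and is the part of \<open>C\<close> above it, so
  \<open>up\<close> is a bijection and depth equals cardinality.\<close>

lemma depth_two_pow:
  assumes C: "C \<in> closed_chains (two_pow S)"
  shows "depth (two_pow S) C \<le> enat n \<longleftrightarrow> finite C \<and> card C \<le> n"
proof -
  have C': "C \<noteq> {}" "closedin (otop (two_pow S)) C" "C \<subseteq> S \<rightarrow>\<^sub>E UNIV"
    and chain: "\<And>x y. x \<in> C \<Longrightarrow> y \<in> C \<Longrightarrow> x \<le> y \<or> y \<le> x"
    using C closedin_subset[of "otop (two_pow S)" C]
    by (simp_all add: closed_chains_two_pow points_two_pow)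
  define Ks where "Ks = {K \<in> closed_chains (two_pow S). ole (CC (two_pow S)) C K}"
  define up where "up = (\<lambda>c. {x \<in> C. c \<le> x})"
  have "up c \<in> Ks" if c: "c \<in> C" for c
  proof -
    \<comment> \<open>\<open>C\<close> may be infinite here, so closedness of \<open>up c\<close>
      comes from intersecting two closed sets.\<close>
    have "up c = C \<inter> {x \<in> S \<rightarrow>\<^sub>E UNIV. c \<le> x}" using C'(3) by (auto simp: up_def)
    then have "closedin (otop (two_pow S)) (up c)"
      using closedin_Int[OF C'(2) closedin_two_pow_above[OF subsetD[OF C'(3) c]]] by simp
    moreover have "c \<in> up c" using c by (simp add: up_def)
    ultimately show ?thesis
      using chain final_part_above[of C c]
      unfolding Ks_def closed_chains_two_pow ole_CC_two_pow[OF C'(3)] up_def by blast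
  qed
  then have sub: "up ` C \<subseteq> Ks" by blast
  have inj: "inj_on up C"
  proof (rule inj_onI)
    fix x y assume "x \<in> C" "y \<in> C" "up x = up y"
    then have "x \<in> up y" "y \<in> up x" by (auto simp: up_def)
    then show "x = y" by (auto simp: up_def)
  qed
  have eq: "Ks = up ` C" if fin: "finite C"
  proof
    show "Ks \<subseteq> up ` C"
    proof
      fix K assume "K \<in> Ks"
      then have K: "K \<noteq> {}" "final_part C K" "K \<subseteq> C"
        using final_partD1[of C K]
        unfolding Ks_def closed_chains_two_pow ole_CC_two_pow[OF C'(3)] by blast+
      then obtain m where m: "m \<in> K" "\<forall>b\<in>K. b \<le> m \<longrightarrow> m = b"
        using finite_has_minimal[of K] finite_subset[OF _ fin] by blast
      have "K = up m"
      proof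
        show "K \<subseteq> up m"
        proof
          fix x assume x: "x \<in> K"
          then have "m \<le> x \<or> x \<le> m" using m(1) K(3) by (intro chain) auto
          then have "m \<le> x" using m(2) x by auto
          then show "x \<in> up m" using x K(3) by (auto simp: up_def)
        qed
        show "up m \<subseteq> K" using final_partD2[OF K(2) m(1)] by (auto simp: up_def)
      qed
      then show "K \<in> up ` C" using m K by blast
    qed
  qed (rule sub)
  show ?thesis
  proof (cases "finite C")
    case True
    then show ?thesis using eq[OF True] card_image[OF inj]
      by (simp add: depth_def Ks_def[symmetric])
  next
    case False
    then have "infinite Ks" using sub inj finite_imageD finite_subset by blast
    then show ?thesis using False by (simp add: depth_def Ks_def[symmetric])
  qed
qed

lemma points_CC_n: "points (CC_n n (two_pow S)) = cube_chains n S"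
proof -
  have "points (CC_n n (two_pow S)) =
      {C \<in> closed_chains (two_pow S). depth (two_pow S) C \<le> enat n}"
    using points_CC[of "two_pow S"] by (auto simp: CC_n_def)
  also have "\<dots> = {C \<in> closed_chains (two_pow S). finite C \<and> card C \<le> n}"
    using depth_two_pow by blast
  also have "\<dots> = cube_chains n S"
  proof -
    have "finite C \<Longrightarrow> closedin (otop (two_pow S)) C \<longleftrightarrow> C \<subseteq> S \<rightarrow>\<^sub>E UNIV" for C
      using closedin_two_pow_finite[of C S] closedin_subset[of "otop (two_pow S)" C]
      by (auto simp only: points_two_pow)
    then show ?thesis
      unfolding cube_chains_def closed_chains_two_pow by (intro Collect_cong) metis
  qed
  finally show ?thesis .
qed

lemma ole_CC_n:
  "C \<in> cube_chains n S \<Longrightarrow> ole (CC_n n (two_pow S)) C K \<longleftrightarrow> final_part C K"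
  using ole_CC_two_pow[of C S K] by (simp add: CC_n_def cube_chains_def)

section \<open>Heyting operations on sets of chains, and the sets they generate\<close>

definition chain_imp :: "nat \<Rightarrow> 'i set \<Rightarrow> ('i \<Rightarrow> bool) set set \<Rightarrow> ('i \<Rightarrow> bool) set set
    \<Rightarrow> ('i \<Rightarrow> bool) set set" where
  "chain_imp n S U V = {C \<in> cube_chains n S. \<forall>K\<in>cube_chains n S. final_part C K \<longrightarrow> K \<in> U \<longrightarrow> K \<in> V}"

lemma cube_chains_closed_chains: "cube_chains n S \<subseteq> closed_chains (two_pow S)"
  unfolding points_CC_n[symmetric] by (auto simp: CC_n_def)

lemma gen_map_eq:
  assumes "s \<in> S"
  shows "gen_map n S s = {C \<in> cube_chains n S. \<forall>c\<in>C. c s}"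
proof -
  have "C \<subseteq> {a \<in> S \<rightarrow>\<^sub>E UNIV. a s = True} \<longleftrightarrow> (\<forall>c\<in>C. c s)" if "C \<in> cube_chains n S" for C
    using cube_chainsD(4)[OF that] by (simp only: Collect_conj_eq Int_subset_iff) auto
  then have "C \<in> gen_map n S s \<longleftrightarrow> C \<in> cube_chains n S \<and> (\<forall>c\<in>C. c s)" for C
    using subsetD[OF cube_chains_closed_chains, of C n S]
    unfolding gen_map_def cc_box_def points_CC_n U_coord_def points_two_pow
    by (cases "C \<in> cube_chains n S") simp_all
  then show ?thesis by blast
qed

lemma himp_clopen_upsets:
  assumes "U \<subseteq> cube_chains n S"
  shows "himp (clopen_upsets (CC_n n (two_pow S))) U V = chain_imp n S U V"
proof -
  have "C \<in> downclosure (ole (CC_n n (two_pow S))) (cube_chains n S) (U - V) \<longleftrightarrow>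
      (\<exists>K\<in>U - V. final_part C K)" if "C \<in> cube_chains n S" for C
    using that by (simp add: downclosure_def ole_CC_n)
  then have "C \<in> cube_chains n S - downclosure (ole (CC_n n (two_pow S))) (cube_chains n S) (U - V)
      \<longleftrightarrow> C \<in> chain_imp n S U V" for C
    using assms unfolding chain_imp_def by blast
  then show ?thesis
    unfolding clopen_upsets_def by (simp add: points_CC_n) blast
qed

text \<open>The subalgebra generated by the sets \<open>gen_map n S s\<close>, written with concrete
  set operations so that induction on generation is available before these sets are identified with
  the clopen upsets.\<close>

inductive_set generated :: "nat \<Rightarrow> 'i set \<Rightarrow> ('i \<Rightarrow> bool) set set set" for n S where
  gen: "s \<in> S \<Longrightarrow> gen_map n S s \<in> generated n S"
| empty: "{} \<in> generated n S"
| whole: "cube_chains n S \<in> generated n S"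
| Int: "\<lbrakk>U \<in> generated n S; V \<in> generated n S\<rbrakk> \<Longrightarrow> U \<inter> V \<in> generated n S"
| Un: "\<lbrakk>U \<in> generated n S; V \<in> generated n S\<rbrakk> \<Longrightarrow> U \<union> V \<in> generated n S"
| imp: "\<lbrakk>U \<in> generated n S; V \<in> generated n S\<rbrakk> \<Longrightarrow> chain_imp n S U V \<in> generated n S"

lemma generated_subset: "U \<in> generated n S \<Longrightarrow> U \<subseteq> cube_chains n S"
  by (induction rule: generated.induct) (auto simp: gen_map_eq chain_imp_def)

lemma generated_upset:
  "\<lbrakk>U \<in> generated n S; C \<in> U; K \<in> cube_chains n S; final_part C K\<rbrakk> \<Longrightarrow> K \<in> U"
proof (induction arbitrary: C rule: generated.induct)
  case (gen s)
  then show ?case using final_partD1[OF gen(4)] by (auto simp: gen_map_eq)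
next
  case (imp U V)
  then show ?case by (auto simp: chain_imp_def intro: final_part_trans)
qed auto

lemma generated_Union: "\<lbrakk>finite \<W>; \<W> \<subseteq> generated n S\<rbrakk> \<Longrightarrow> \<Union>\<W> \<in> generated n S"
  by (induction rule: finite_induct) (auto intro: generated.intros)

text \<open>Intersecting with \<open>cube_chains n S\<close> gives the empty family its proper
  value, the whole space.\<close>

lemma generated_Inter:
  "\<lbrakk>finite \<W>; \<W> \<subseteq> generated n S\<rbrakk> \<Longrightarrow> cube_chains n S \<inter> \<Inter>\<W> \<in> generated n S"
proof (induction rule: finite_induct)
  case (insert W \<W>)
  have "cube_chains n S \<inter> \<Inter>(insert W \<W>) = W \<inter> (cube_chains n S \<inter> \<Inter>\<W>)" by blast
  then show ?case using insert generated.Int[of W n S "cube_chains n S \<inter> \<Inter>\<W>"] by simp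
qed (simp add: generated.whole)

section \<open>Dependence on finitely many coordinates\<close>

definition determined_by :: "nat \<Rightarrow> 'i set \<Rightarrow> 'i set \<Rightarrow> ('i \<Rightarrow> bool) set set \<Rightarrow> bool" where
  "determined_by n S T U \<longleftrightarrow> (\<forall>C\<in>cube_chains n S. \<forall>K\<in>cube_chains n S.
     (\<lambda>c. restrict c T) ` C = (\<lambda>c. restrict c T) ` K \<longrightarrow> C \<in> U \<longrightarrow> K \<in> U)"

lemma determined_byD:
  assumes "determined_by n S T U" "C \<in> cube_chains n S" "K \<in> cube_chains n S"
    and "(\<lambda>c. restrict c T) ` C = (\<lambda>c. restrict c T) ` K" "C \<in> U"
  shows "K \<in> U"
  by (rule assms(1)[unfolded determined_by_def, rule_format, OF assms(2-5)])

lemma determined_by_mono: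
  assumes "determined_by n S T U" "T \<subseteq> T'"
  shows "determined_by n S T' U"
  unfolding determined_by_def
proof (intro ballI impI)
  fix C K assume CK: "C \<in> cube_chains n S" "K \<in> cube_chains n S" "C \<in> U"
    and eq: "(\<lambda>c. restrict c T') ` C = (\<lambda>c. restrict c T') ` K"
  \<comment> \<open>Restriction to \<open>T\<close> factors through restriction to the larger set
    \<open>T'\<close>.\<close>
  have "(\<lambda>c. restrict c T) ` A = (\<lambda>c. restrict c T) ` (\<lambda>c. restrict c T') ` A" for A :: "('a \<Rightarrow> bool) set"
    using assms(2) by (simp add: image_image Int_absorb1)
  then have "(\<lambda>c. restrict c T) ` C = (\<lambda>c. restrict c T) ` K" using eq by metis
  then show "K \<in> U" by (rule determined_byD[OF assms(1) CK(1,2) _ CK(3)])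
qed

text \<open>A final part \<open>K'\<close> of \<open>C'\<close> pulls back to the set
  \<open>K\<close> of those members of \<open>C\<close> whose restriction occurs in
  \<open>K'\<close>. This is a final part of \<open>C\<close> with the same restrictions as
  \<open>K'\<close>, so membership in \<open>U\<close> and in \<open>V\<close> transfers between the
  two.\<close>

lemma chain_imp_determined:
  assumes U: "determined_by n S T U" and V: "determined_by n S T V"
  shows "determined_by n S T (chain_imp n S U V)"
  unfolding determined_by_def
proof (intro ballI impI)
  fix C C' assume C: "C \<in> cube_chains n S" "C' \<in> cube_chains n S" "C \<in> chain_imp n S U V"
  define r where "r = (\<lambda>c::'a \<Rightarrow> bool. restrict c T)"
  assume "(\<lambda>c. restrict c T) ` C = (\<lambda>c. restrict c T) ` C'"
  then have eq: "r ` C = r ` C'" by (simp add: r_def)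
  have rmono: "x \<le> y \<Longrightarrow> r x \<le> r y" for x y by (auto simp: r_def le_fun_def restrict_def)
  have "K' \<in> V" if K': "K' \<in> cube_chains n S" "final_part C' K'" "K' \<in> U" for K'
  proof -
    define K where "K = {c \<in> C. r c \<in> r ` K'}"
    have "r ` K' \<subseteq> r ` C" using final_partD1[OF K'(2)] eq by auto
    moreover have "r ` K = r ` C \<inter> r ` K'" by (auto simp: K_def)
    ultimately have rK: "r ` K = r ` K'" by blast
    have "K' \<noteq> {}" using K' by (simp add: cube_chains_def)
    then have "K \<noteq> {}" using rK by blast
    have fin: "final_part C K"
    proof (rule final_partI)
      show "K \<subseteq> C" by (auto simp: K_def)
      fix c d assume c: "c \<in> K" and d: "d \<in> C" and le: "c \<le> d"
      obtain k where k: "k \<in> K'" "r c = r k" using c by (auto simp: K_def)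
      obtain d' where d': "d' \<in> C'" "r d = r d'" using d eq by blast
      have "k \<in> C'" using k final_partD1[OF K'(2)] by blast
      then consider "k \<le> d'" | "d' \<le> k" using d' cube_chain_total[OF C(2)] by blast
      then have "r d \<in> r ` K'"
      proof cases
        case 1
        then have "d' \<in> K'" by (rule final_partD2[OF K'(2) k(1) d'(1)])
        then show ?thesis using d' by blast
      next
        case 2
        \<comment> \<open>Here \<open>r d = r d' \<le> r k = r c \<le> r d\<close>.\<close>
        then have "r d = r k" using rmono[OF 2] rmono[OF le] k d' by (simp add: order_antisym)
        then show ?thesis using k by blast
      qed
      then show "d \<in> K" using d by (simp add: K_def)
    qed
    have Kc: "K \<in> cube_chains n S" using cube_chains_final[OF C(1) fin \<open>K \<noteq> {}\<close>] .
    have rK': "(\<lambda>c. restrict c T) ` K = (\<lambda>c. restrict c T) ` K'" using rK by (simp add: r_def)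
    have "K \<in> U" by (rule determined_byD[OF U K'(1) Kc rK'[symmetric] K'(3)])
    then have "K \<in> V" using C(3) Kc fin by (simp add: chain_imp_def)
    then show ?thesis by (rule determined_byD[OF V Kc K'(1) rK'])
  qed
  then show "C' \<in> chain_imp n S U V" using C(2) by (simp add: chain_imp_def)
qed

lemma generated_determined:
  "U \<in> generated n S \<Longrightarrow> \<exists>T. finite T \<and> T \<subseteq> S \<and> determined_by n S T U"
proof (induction rule: generated.induct)
  case (gen s)
  have "determined_by n S {s} (gen_map n S s)"
    unfolding determined_by_def
  proof (intro ballI impI)
    fix C K assume C: "C \<in> cube_chains n S" "K \<in> cube_chains n S" "C \<in> gen_map n S s"
      and eq: "(\<lambda>c. restrict c {s}) ` C = (\<lambda>c. restrict c {s}) ` K"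
    have "k s" if k: "k \<in> K" for k
    proof -
      have "restrict k {s} \<in> (\<lambda>c. restrict c {s}) ` C" unfolding eq using k by (rule imageI)
      then obtain c where "restrict k {s} = restrict c {s}" "c \<in> C" by (rule imageE)
      then have "k s = c s" by (metis restrict_apply' singletonI)
      then show ?thesis using C(3) \<open>c \<in> C\<close> unfolding gen_map_eq[OF gen] by blast
    qed
    then show "K \<in> gen_map n S s" unfolding gen_map_eq[OF gen] using C(2) by blast
  qed
  then show ?case using gen by (intro exI[of _ "{s}"]) simp
next
  case empty
  show ?case by (intro exI[of _ "{}"]) (simp add: determined_by_def)
next
  case whole
  show ?case by (intro exI[of _ "{}"]) (simp add: determined_by_def)
next
  case (Int U V)
  then obtain T T' where T: "finite T" "T \<subseteq> S" "determined_by n S T U"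
    "finite T'" "T' \<subseteq> S" "determined_by n S T' V" by blast
  then have "determined_by n S (T \<union> T') U" "determined_by n S (T \<union> T') V"
    by (auto intro: determined_by_mono)
  then have "determined_by n S (T \<union> T') (U \<inter> V)"
    unfolding determined_by_def Int_iff by metis
  then show ?case using T by (intro exI[of _ "T \<union> T'"]) simp
next
  case (Un U V)
  then obtain T T' where T: "finite T" "T \<subseteq> S" "determined_by n S T U"
    "finite T'" "T' \<subseteq> S" "determined_by n S T' V" by blast
  then have "determined_by n S (T \<union> T') U" "determined_by n S (T \<union> T') V"
    by (auto intro: determined_by_mono)
  then have "determined_by n S (T \<union> T') (U \<union> V)"
    unfolding determined_by_def Un_iff by metis
  then show ?case using T by (intro exI[of _ "T \<union> T'"]) simp
next
  case (imp U V)
  then obtain T T' where T: "finite T" "T \<subseteq> S" "determined_by n S T U"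
    "finite T'" "T' \<subseteq> S" "determined_by n S T' V" by blast
  then have "determined_by n S (T \<union> T') U" "determined_by n S (T \<union> T') V"
    by (auto intro: determined_by_mono)
  then have "determined_by n S (T \<union> T') (chain_imp n S U V)" by (rule chain_imp_determined)
  then show ?case using T by (intro exI[of _ "T \<union> T'"]) simp
qed

section \<open>Separation of chains by generated sets\<close>

definition literals :: "'i set \<Rightarrow> (('i \<Rightarrow> bool) \<Rightarrow> bool) set" where
  "literals S = {\<lambda>_. True, \<lambda>_. False} \<union> (\<lambda>s c. c s) ` S"

lemma literal_mono: "\<lbrakk>q \<in> literals S; q x; x \<le> y\<rbrakk> \<Longrightarrow> q y"
  by (auto simp: literals_def le_fun_def)

lemma coordinate_literal: "s \<in> S \<Longrightarrow> (\<lambda>c. c s) \<in> literals S"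
  unfolding literals_def by blast

text \<open>The constants give the whole space and, because chains are nonempty, the empty set;
  coordinates give the generators.\<close>

lemma literal_box_generated:
  assumes "q \<in> literals S"
  shows "{C \<in> cube_chains n S. \<forall>c\<in>C. q c} \<in> generated n S"
proof -
  consider "q = (\<lambda>_. True)" | "q = (\<lambda>_. False)" | s where "s \<in> S" "q = (\<lambda>c. c s)"
    using assms unfolding literals_def by blast
  then show ?thesis
  proof cases
    case 1
    then show ?thesis by (simp add: generated.whole)
  next
    case 2
    then have "{C \<in> cube_chains n S. \<forall>c\<in>C. q c} = {}" using cube_chainsD(1) by auto
    then show ?thesis by (simp only: generated.empty)
  next
    case 3
    then show ?thesis using generated.gen[OF 3(1), of n] gen_map_eq[OF 3(1), of n] by simp
  qed
qed

text \<open>\<open>A\<close> is a finite chain, so it suffices to exclude its greatest element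
  \<open>m\<close>: a coordinate true at \<open>d\<close> and false at \<open>m\<close> is false at
  everything below \<open>m\<close>.\<close>

lemma separating_literal_above:
  assumes "finite A" "A \<subseteq> S \<rightarrow>\<^sub>E UNIV" "d \<in> S \<rightarrow>\<^sub>E UNIV" "\<And>a. a \<in> A \<Longrightarrow> \<not> d \<le> a"
    and total: "\<And>x y. x \<in> A \<Longrightarrow> y \<in> A \<Longrightarrow> x \<le> y \<or> y \<le> x"
  obtains q where "q \<in> literals S" "q d" "\<And>a. a \<in> A \<Longrightarrow> \<not> q a"
proof (cases "A = {}")
  case True
  \<comment> \<open>There may be no coordinate at which \<open>d\<close> is true, so a constant is
    used.\<close>
  show ?thesis by (rule that[of "\<lambda>_. True"]) (use True in \<open>simp_all add: literals_def\<close>)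
next
  case False
  obtain m where m: "m \<in> A" "\<forall>b\<in>A. m \<le> b \<longrightarrow> m = b"
    using finite_has_maximal[OF assms(1) False] by blast
  obtain s where s: "s \<in> S" "d s" "\<not> m s"
    using cube_not_le[of d S m] assms m by blast
  have "\<not> a s" if a: "a \<in> A" for a
  proof -
    have "a \<le> m" using total[OF a m(1)] m(2) a by auto
    then show ?thesis using s by (auto simp: le_fun_def)
  qed
  then show ?thesis by (rule that[OF coordinate_literal[OF s(1)] s(2)])
qed

text \<open>Dually, a coordinate true at the least element of \<open>B\<close> is true on all of
  \<open>B\<close>.\<close>

lemma separating_literal_below:
  assumes "finite B" "B \<subseteq> S \<rightarrow>\<^sub>E UNIV" "d \<in> S \<rightarrow>\<^sub>E UNIV" "\<And>b. b \<in> B \<Longrightarrow> \<not> b \<le> d"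
    and total: "\<And>x y. x \<in> B \<Longrightarrow> y \<in> B \<Longrightarrow> x \<le> y \<or> y \<le> x"
  obtains q where "q \<in> literals S" "\<not> q d" "\<And>b. b \<in> B \<Longrightarrow> q b"
proof (cases "B = {}")
  case True
  show ?thesis by (rule that[of "\<lambda>_. False"]) (use True in \<open>simp_all add: literals_def\<close>)
next
  case False
  obtain m where m: "m \<in> B" "\<forall>b\<in>B. b \<le> m \<longrightarrow> m = b"
    using finite_has_minimal[OF assms(1) False] by blast
  obtain s where s: "s \<in> S" "m s" "\<not> d s"
    using cube_not_le[of m S d] assms m by blast
  have "b s" if b: "b \<in> B" for b
  proof -
    have "m \<le> b" using total[OF b m(1)] m(2) b by auto
    then show ?thesis using s by (auto simp: le_fun_def)
  qed
  then show ?thesis by (rule that[OF coordinate_literal[OF s(1)] s(3)])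
qed

lemma chain_impI:
  "\<lbrakk>C \<in> cube_chains n S; \<And>K. \<lbrakk>K \<in> cube_chains n S; final_part C K; K \<in> U\<rbrakk> \<Longrightarrow> K \<in> V\<rbrakk>
    \<Longrightarrow> C \<in> chain_imp n S U V"
  by (simp add: chain_imp_def)

lemma chain_impD:
  "\<lbrakk>C \<in> chain_imp n S U V; K \<in> cube_chains n S; final_part C K; K \<in> U\<rbrakk> \<Longrightarrow> K \<in> V"
  by (simp add: chain_imp_def)

text \<open>
  The separating term is \<open>q1 \<rightharpoonup> q0\<close>: the literal \<open>q1\<close> holds at \<open>d\<close> but at no member of \<open>C\<close>
  outside the up-closure of \<open>d\<close>, while \<open>q0\<close> fails at \<open>d\<close> but holds at all members of \<open>C\<close> above \<open>d\<close>.
\<close>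

lemma separate_not_subset:
  assumes C: "C \<in> cube_chains n S" and K: "K \<in> cube_chains n S" and dK: "d \<in> K" "d \<notin> C"
  shows "\<exists>W\<in>generated n S. C \<in> W \<and> K \<notin> W"
proof -
  note CD = cube_chainsD[OF C] and tot = cube_chain_total[OF C]
  have d: "d \<in> S \<rightarrow>\<^sub>E UNIV" using dK cube_chainsD(4)[OF K] by blast
  let ?A = "{c \<in> C. \<not> d \<le> c}" and ?B = "{c \<in> C. d \<le> c}"
  obtain q1 where q1: "q1 \<in> literals S" "q1 d" "\<And>c. c \<in> ?A \<Longrightarrow> \<not> q1 c"
    by (rule separating_literal_above[of ?A S d]) (use CD d tot in \<open>simp_all add: subset_iff\<close>)
  \<comment> \<open>\<open>c \<le> d\<close> would give \<open>c = d\<close>, although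
    \<open>d\<close> is not in \<open>C\<close>.\<close>
  have B: "\<not> c \<le> d" if "c \<in> ?B" for c
    using that dK by (metis (mono_tags, lifting) mem_Collect_eq order_antisym)
  obtain q0 where q0: "q0 \<in> literals S" "\<not> q0 d" "\<And>c. c \<in> ?B \<Longrightarrow> q0 c"
    by (rule separating_literal_below[of ?B S d]) (use CD d tot B in \<open>simp_all add: subset_iff\<close>)
  define W where "W = chain_imp n S {C \<in> cube_chains n S. \<forall>c\<in>C. q1 c} {C \<in> cube_chains n S. \<forall>c\<in>C. q0 c}"
  have "W \<in> generated n S"
    unfolding W_def by (intro generated.imp literal_box_generated q0 q1)
  moreover have "C \<in> W"
    unfolding W_def
  proof (rule chain_impI[OF C])
    fix L assume L: "L \<in> cube_chains n S" "final_part C L" "L \<in> {C \<in> cube_chains n S. \<forall>c\<in>C. q1 c}"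
    have "q0 c" if c: "c \<in> L" for c
    proof -
      have "q1 c" "c \<in> C" using L c final_partD1[OF L(2)] by auto
      then have "d \<le> c" using q1(3)[of c] by blast
      then show ?thesis using q0(3)[of c] \<open>c \<in> C\<close> by blast
    qed
    then show "L \<in> {C \<in> cube_chains n S. \<forall>c\<in>C. q0 c}" using L(1) by blast
  qed
  moreover have "K \<notin> W"
  proof
    assume KW: "K \<in> W"
    \<comment> \<open>This final part of \<open>K\<close> satisfies \<open>q1\<close> throughout by
      monotonicity, but contains \<open>d\<close>, where \<open>q0\<close> fails.\<close>
    let ?L = "{x \<in> K. d \<le> x}"
    have L: "?L \<in> cube_chains n S" by (rule cube_chains_above[OF K dK(1)])
    have "\<forall>c\<in>?L. q1 c" using literal_mono[OF q1(1,2)] by simp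
    then have "?L \<in> {C \<in> cube_chains n S. \<forall>c\<in>C. q0 c}"
      using L by (intro chain_impD[OF KW[unfolded W_def] L final_part_above]) simp
    then show False using q0(2) dK(1) by auto
  qed
  ultimately show ?thesis by blast
qed

text \<open>
  The separating term is \<open>(q1 \<rightharpoonup> q0) \<rightharpoonup> q0\<close>. Here \<open>m\<close> is the largest element of \<open>C\<close> below
  all members of \<open>K\<close> above \<open>c\<close>; at \<open>m\<close> the literal \<open>q1\<close> holds and \<open>q0\<close> fails, so the point \<open>m\<close>, which \<open>K\<close> omits,
  refutes \<open>q1 \<rightharpoonup> q0\<close> in \<open>C\<close> but not in \<open>K\<close>.
\<close>

lemma separate_not_final:
  assumes C: "C \<in> cube_chains n S" and K: "K \<in> cube_chains n S" and KC: "K \<subseteq> C"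
    and dc: "d \<in> K" "c \<in> C" "d \<le> c" "c \<notin> K"
  shows "\<exists>W\<in>generated n S. C \<in> W \<and> K \<notin> W"
proof -
  note CD = cube_chainsD[OF C] and tot = cube_chain_total[OF C]
  note KD = cube_chainsD[OF K] and totK = cube_chain_total[OF K]
  \<comment> \<open>\<open>E\<close> is empty when \<open>c\<close> lies above all of
    \<open>K\<close>; then \<open>m\<close> is the greatest element of \<open>C\<close>, and
    \<open>q0\<close> can be constantly false.\<close>
  define E where "E = {e \<in> K. c \<le> e}"
  define M where "M = {x \<in> C. \<forall>e\<in>E. \<not> e \<le> x}"
  have "\<not> e \<le> c" if "e \<in> E" for e
    using that dc(4) unfolding E_def by (metis (mono_tags, lifting) mem_Collect_eq order_antisym)
  then have cM: "c \<in> M" using dc(2) by (simp add: M_def)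
  have "finite M" using CD(2) by (simp add: M_def)
  then obtain m where m: "m \<in> M" "\<forall>b\<in>M. m \<le> b \<longrightarrow> m = b"
    using finite_has_maximal[of M] cM by blast
  have mC: "m \<in> C" and mE: "\<And>e. e \<in> E \<Longrightarrow> \<not> e \<le> m" using m(1) by (auto simp: M_def)
  have top: "x \<le> m" if "x \<in> M" for x
    using tot[of x m] that m mC by (auto simp: M_def)
  have cm: "c \<le> m" using top[OF cM] .
  have mS: "m \<in> S \<rightarrow>\<^sub>E UNIV" using mC CD(4) by blast
  let ?A = "{k \<in> K. \<not> m \<le> k}"
  obtain q1 where q1: "q1 \<in> literals S" "q1 m" "\<And>k. k \<in> ?A \<Longrightarrow> \<not> q1 k"
    by (rule separating_literal_above[of ?A S m]) (use KD mS totK in \<open>simp_all add: subset_iff\<close>)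
  obtain q0 where q0: "q0 \<in> literals S" "\<not> q0 m" "\<And>e. e \<in> E \<Longrightarrow> q0 e"
    by (rule separating_literal_below[of E S m])
      (use KD mS totK mE in \<open>simp_all add: subset_iff E_def\<close>)
  define B1 where "B1 = {C \<in> cube_chains n S. \<forall>c\<in>C. q1 c}"
  define B0 where "B0 = {C \<in> cube_chains n S. \<forall>c\<in>C. q0 c}"
  define W where "W = chain_imp n S (chain_imp n S B1 B0) B0"
  have "W \<in> generated n S"
    unfolding W_def B1_def B0_def by (intro generated.imp literal_box_generated q0 q1)
  moreover have "K \<notin> W"
  proof
    assume KW: "K \<in> W"
    have "K \<in> chain_imp n S B1 B0"
    proof (rule chain_impI[OF K])
      fix L assume L: "L \<in> cube_chains n S" "final_part K L" "L \<in> B1"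
      have "q0 x" if x: "x \<in> L" for x
      proof -
        have "q1 x" "x \<in> K" using L x final_partD1[OF L(2)] by (auto simp: B1_def)
        then have "m \<le> x" using q1(3)[of x] by blast
        then have "x \<in> E" using order_trans[OF cm] \<open>x \<in> K\<close> by (simp add: E_def)
        then show ?thesis by (rule q0(3))
      qed
      then show "L \<in> B0" using L(1) by (simp add: B0_def)
    qed
    then have "K \<in> B0" by (rule chain_impD[OF KW[unfolded W_def] K final_part_refl])
    then have "q0 d" using dc(1) by (simp add: B0_def)
    \<comment> \<open>As \<open>d \<le> c \<le> m\<close> and literals are monotone,
      \<open>q0\<close> at \<open>d\<close> would give \<open>q0\<close> at
      \<open>m\<close>.\<close>
    then show False using literal_mono[OF q0(1), of d m] q0(2) order_trans[OF dc(3) cm] by simp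
  qed
  moreover have "C \<in> W"
    unfolding W_def
  proof (rule chain_impI[OF C])
    fix D assume D: "D \<in> cube_chains n S" "final_part C D" "D \<in> chain_imp n S B1 B0"
    have "q0 x" if x: "x \<in> D" for x
    proof (rule ccontr)
      assume neg: "\<not> q0 x"
      \<comment> \<open>Failure of \<open>q0\<close> at \<open>x\<close> places \<open>x\<close>
        below \<open>m\<close>, so the final part \<open>D\<close> contains \<open>m\<close>, and
        the part of \<open>D\<close> from \<open>m\<close> upwards refutes the implication from
        \<open>q1\<close> to \<open>q0\<close>.\<close>
      have "\<not> e \<le> x" if "e \<in> E" for e
        using literal_mono[OF q0(1) q0(3)[OF that]] neg by blast
      then have "x \<in> M" using x final_partD1[OF D(2)] by (auto simp: M_def)
      then have "m \<in> D" using final_partD2[OF D(2) x mC] top by simp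
      let ?L = "{y \<in> D. m \<le> y}"
      have L: "?L \<in> cube_chains n S" by (rule cube_chains_above[OF D(1) \<open>m \<in> D\<close>])
      have "?L \<in> B1" using literal_mono[OF q1(1,2)] L by (simp add: B1_def)
      then have "?L \<in> B0" by (rule chain_impD[OF D(3) L final_part_above])
      then show False using q0(2) \<open>m \<in> D\<close> by (simp add: B0_def)
    qed
    then show "D \<in> B0" using D(1) by (simp add: B0_def)
  qed
  ultimately show ?thesis by blast
qed

lemma separate:
  assumes C: "C \<in> cube_chains n S" and K: "K \<in> cube_chains n S" and neg: "\<not> final_part C K"
  shows "\<exists>W\<in>generated n S. C \<in> W \<and> K \<notin> W"
proof (cases "K \<subseteq> C")
  case True
  then obtain d c where "d \<in> K" "c \<in> C" "d \<le> c" "c \<notin> K"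
    using neg final_partI[of K C] by metis
  then show ?thesis using separate_not_final[OF C K True] by metis
next
  case False
  then obtain d where "d \<in> K" "d \<notin> C" unfolding subset_iff by metis
  then show ?thesis using separate_not_subset[OF C K] by metis
qed

section \<open>Topology of the space of chains\<close>

text \<open>The set is a union of boxes, each fixing the coordinates in \<open>T\<close>; these are
  open because \<open>T\<close> is finite.\<close>

lemma two_pow_cylinder_open:
  assumes "finite T" "T \<subseteq> S"
  shows "openin (otop (two_pow S)) {x \<in> S \<rightarrow>\<^sub>E UNIV. restrict x T \<in> D}"
proof -
  define cyl where "cyl = (\<lambda>y::'a \<Rightarrow> bool. \<Pi>\<^sub>E i\<in>S. if i \<in> T then {y i} else UNIV)"
  have "openin (otop (two_pow S)) (cyl y)" for y
  proof -
    have "finite {i \<in> S. (if i \<in> T then {y i} else UNIV) \<noteq> topspace (discrete_topology UNIV)}"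
      by (rule finite_subset[OF _ assms(1)]) auto
    then show ?thesis
      unfolding cyl_def two_pow_def ordered_space.simps openin_PiE_gen by simp
  qed
  moreover have "{x \<in> S \<rightarrow>\<^sub>E UNIV. restrict x T \<in> D} = \<Union> (cyl ` {x \<in> S \<rightarrow>\<^sub>E UNIV. restrict x T \<in> D})"
  proof (intro equalityI subsetI)
    fix x assume "x \<in> {x \<in> S \<rightarrow>\<^sub>E UNIV. restrict x T \<in> D}"
    moreover from this have "x \<in> cyl x" by (auto simp: cyl_def PiE_iff)
    ultimately show "x \<in> \<Union> (cyl ` {x \<in> S \<rightarrow>\<^sub>E UNIV. restrict x T \<in> D})" by blast
  next
    fix x assume "x \<in> \<Union> (cyl ` {x \<in> S \<rightarrow>\<^sub>E UNIV. restrict x T \<in> D})"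
    then obtain y where y: "restrict y T \<in> D" "x \<in> cyl y" by blast
    have "x i = y i" if "i \<in> T" for i
      using y(2) that assms(2) by (auto simp: cyl_def PiE_iff split: if_splits)
    then have "restrict x T = restrict y T" by (auto simp: restrict_def)
    moreover have "x \<in> S \<rightarrow>\<^sub>E UNIV" using y(2) by (auto simp: cyl_def PiE_iff)
    ultimately show "x \<in> {x \<in> S \<rightarrow>\<^sub>E UNIV. restrict x T \<in> D}" using y(1) by simp
  qed
  ultimately show ?thesis by (metis (no_types, lifting) imageE openin_Union)
qed

lemma two_pow_cylinder_clopen:
  assumes "finite T" "T \<subseteq> S"
  shows "clopen_in (otop (two_pow S)) {x \<in> S \<rightarrow>\<^sub>E UNIV. restrict x T \<in> D}"
proof -
  have "(S \<rightarrow>\<^sub>E UNIV) - {x \<in> S \<rightarrow>\<^sub>E UNIV. restrict x T \<in> D} =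
      {x \<in> S \<rightarrow>\<^sub>E UNIV. restrict x T \<in> - D}" by auto
  then show ?thesis
    using two_pow_cylinder_open[OF assms, of D] two_pow_cylinder_open[OF assms, of "- D"]
    by (simp add: clopen_in_def closedin_def points_two_pow)
qed

lemma openin_CC_n_box:
  assumes "clopen_in (otop (two_pow S)) V"
  shows "openin (otop (CC_n n (two_pow S))) {C \<in> cube_chains n S. C \<subseteq> V}"
    and "openin (otop (CC_n n (two_pow S))) {C \<in> cube_chains n S. C \<inter> V \<noteq> {}}"
proof -
  let ?T = "otop (CC (two_pow S))"
  have o: "openin ?T (cc_box (two_pow S) V)" "openin ?T (cc_diamond (two_pow S) V)"
    unfolding CC_def ordered_space.simps
    by (rule topology_generated_by_Basis; use assms in blast)+
  have top: "otop (CC_n n (two_pow S)) = subtopology ?T (cube_chains n S)"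
  proof -
    have "{C \<in> closed_chains (two_pow S). depth (two_pow S) C \<le> enat n} = cube_chains n S"
      unfolding points_CC_n[symmetric] using points_CC[of "two_pow S"] by (auto simp: CC_n_def)
    then show ?thesis by (simp add: CC_n_def)
  qed
  have "{C \<in> cube_chains n S. C \<subseteq> V} = cc_box (two_pow S) V \<inter> cube_chains n S"
    "{C \<in> cube_chains n S. C \<inter> V \<noteq> {}} = cc_diamond (two_pow S) V \<inter> cube_chains n S"
    using cube_chains_closed_chains[of n S] by (auto simp: cc_box_def cc_diamond_def)
  then show "openin (otop (CC_n n (two_pow S))) {C \<in> cube_chains n S. C \<subseteq> V}"
    "openin (otop (CC_n n (two_pow S))) {C \<in> cube_chains n S. C \<inter> V \<noteq> {}}"
    using o unfolding top by (simp_all add: openin_subtopology_Int)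
qed

text \<open>As \<open>C\<close> is finite, the neighbourhood \<open>N\<close> is cut out by one box
  and finitely many diamonds. The box forces every restriction of a member of \<open>K\<close> to
  occur in \<open>C\<close>, the diamonds force every restriction of a member of \<open>C\<close> to
  occur in \<open>K\<close>, so \<open>N\<close> consists of chains with the same restrictions as
  \<open>C\<close>.\<close>

lemma openin_determined:
  assumes T: "finite T" "T \<subseteq> S" and det: "determined_by n S T U" and U: "U \<subseteq> cube_chains n S"
  shows "openin (otop (CC_n n (two_pow S))) U"
proof (subst openin_subopen, rule ballI)
  fix C assume CU: "C \<in> U"
  then have C: "C \<in> cube_chains n S" using U by blast
  define r where "r = (\<lambda>c::'a \<Rightarrow> bool. restrict c T)"
  define cyl where "cyl = (\<lambda>D. {x :: 'a \<Rightarrow> bool. x \<in> S \<rightarrow>\<^sub>E UNIV \<and> restrict x T \<in> D})"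
  define N where "N = {K \<in> cube_chains n S. K \<subseteq> cyl (r ` C)} \<inter>
    (\<Inter>d\<in>C. {K \<in> cube_chains n S. K \<inter> cyl {r d} \<noteq> {}})"
  have clop: "clopen_in (otop (two_pow S)) (cyl D)" for D
    unfolding cyl_def by (rule two_pow_cylinder_clopen[OF T])
  have "openin (otop (CC_n n (two_pow S))) N"
    unfolding N_def using cube_chainsD(1,2)[OF C]
    by (intro openin_Int openin_Inter openin_CC_n_box clop) (auto intro: openin_CC_n_box clop)
  moreover have "C \<in> N"
    unfolding N_def cyl_def r_def using C cube_chainsD(4)[OF C] by auto
  moreover have "N \<subseteq> U"
  proof
    fix K assume K: "K \<in> N"
    then have Kc: "K \<in> cube_chains n S" by (simp add: N_def)
    have "r ` K \<subseteq> r ` C" using K by (auto simp: N_def cyl_def r_def)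
    moreover have "r ` C \<subseteq> r ` K"
    proof
      fix y assume "y \<in> r ` C"
      then obtain d where d: "d \<in> C" "y = r d" by blast
      then have "K \<inter> cyl {r d} \<noteq> {}" using K by (simp add: N_def)
      then obtain k where "k \<in> K" "r k = r d" by (auto simp: cyl_def r_def)
      then show "y \<in> r ` K" using d by (metis imageI)
    qed
    ultimately have "(\<lambda>c. restrict c T) ` C = (\<lambda>c. restrict c T) ` K" by (auto simp: r_def)
    then show "K \<in> U" by (rule determined_byD[OF det C Kc _ CU])
  qed
  ultimately show "\<exists>N. openin (otop (CC_n n (two_pow S))) N \<and> C \<in> N \<and> N \<subseteq> U" by blast
qed

text \<open>The complement is determined by the same coordinates, hence open as well.\<close>

lemma clopen_determined:
  assumes T: "finite T" "T \<subseteq> S" and det: "determined_by n S T U" and U: "U \<subseteq> cube_chains n S"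
  shows "clopen_in (otop (CC_n n (two_pow S))) U"
proof -
  have "determined_by n S T (cube_chains n S - U)"
    unfolding determined_by_def
  proof (intro ballI impI)
    fix C K assume CK: "C \<in> cube_chains n S" "K \<in> cube_chains n S" "C \<in> cube_chains n S - U"
      and eq: "(\<lambda>c. restrict c T) ` C = (\<lambda>c. restrict c T) ` K"
    then have "K \<notin> U" using determined_byD[OF det CK(2,1) eq[symmetric]] by auto
    then show "K \<in> cube_chains n S - U" using CK by simp
  qed
  then have "openin (otop (CC_n n (two_pow S))) (cube_chains n S - U)"
    by (rule openin_determined[OF T]) auto
  then show ?thesis
    using openin_determined[OF assms] U by (simp add: clopen_in_def closedin_def points_CC_n)
qed

lemma generated_clopen: "U \<in> generated n S \<Longrightarrow> clopen_in (otop (CC_n n (two_pow S))) U"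
  using generated_determined[of U n S] generated_subset[of U n S] clopen_determined by metis

text \<open>Counting for each \<open>s\<close> the members of a chain that contain \<open>s\<close> encodes a chain as a
  function to \<open>{0..n}\<close>, once the full count is replaced by \<open>n\<close>.\<close>

definition level_chain :: "nat \<Rightarrow> 'i set \<Rightarrow> ('i \<Rightarrow> nat) \<Rightarrow> ('i \<Rightarrow> bool) set" where
  "level_chain n S h = (\<lambda>i. \<lambda>s\<in>S. i \<le> h s) ` {1..n}"

text \<open>Raising the threshold \<open>i\<close> makes fewer coordinates true, so the levels form
  a chain. For \<open>n = 0\<close> there is no threshold and the chain would be empty.\<close>

lemma level_chain_in_cube_chains:
  assumes "n \<noteq> 0"
  shows "level_chain n S h \<in> cube_chains n S"
proof -
  have "card (level_chain n S h) \<le> n"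
    unfolding level_chain_def using card_image_le[of "{1..n}"] by force
  moreover have "x \<le> y \<or> y \<le> x" if xy: "x \<in> level_chain n S h" "y \<in> level_chain n S h" for x y
  proof -
    obtain i j where ij: "x = (\<lambda>s\<in>S. i \<le> h s)" "y = (\<lambda>s\<in>S. j \<le> h s)"
      using xy unfolding level_chain_def by blast
    have "i \<le> j \<Longrightarrow> y \<le> x" "j \<le> i \<Longrightarrow> x \<le> y"
      unfolding ij by (auto simp: le_fun_def restrict_def)
    then show ?thesis using nat_le_linear by blast
  qed
  moreover have "level_chain n S h \<noteq> {}" "finite (level_chain n S h)"
    "level_chain n S h \<subseteq> S \<rightarrow>\<^sub>E UNIV"
    using assms by (auto simp: level_chain_def)
  ultimately show ?thesis by (simp add: cube_chains_def)
qed

text \<open>Ranks count from the top of \<open>C\<close>, starting at 1. A member is true at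
  \<open>s\<close> iff its rank is at most the number \<open>u s\<close> of members true at
  \<open>s\<close>, so the threshold \<open>i\<close> recovers the member of rank
  \<open>i\<close>.\<close>

lemma level_chain_surj:
  assumes C: "C \<in> cube_chains n S"
  obtains h where "h \<in> S \<rightarrow>\<^sub>E {..n}" "level_chain n S h = C"
proof -
  note D = cube_chainsD[OF C] and total = cube_chain_total[OF C]
  define m where "m = card C"
  define u where "u = (\<lambda>s. card {c \<in> C. c s})"
  define rk where "rk = (\<lambda>c. card {d \<in> C. c \<le> d})"
  \<comment> \<open>The value \<open>n\<close> at full count makes all thresholds from
    \<open>m\<close> to \<open>n\<close> repeat the least member; with \<open>m\<close> there,
    thresholds beyond \<open>m\<close> would add the point that is false throughout
    \<open>S\<close>.\<close>
  define h where "h = (\<lambda>s\<in>S. if u s < m then u s else n)"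
  define a where "a = (\<lambda>i. \<lambda>s\<in>S. i \<le> h s)"
  have mn: "m \<le> n" "m > 0" using D by (auto simp: m_def card_gt_0_iff)
  have um: "u s \<le> m" for s unfolding u_def m_def using D by (intro card_mono) auto
  have rk_pos: "rk c \<in> {1..m}" if "c \<in> C" for c
  proof -
    have "{d \<in> C. c \<le> d} \<noteq> {}" using that by blast
    then have "rk c > 0" unfolding rk_def using D(2) by (simp add: card_gt_0_iff)
    moreover have "rk c \<le> m" unfolding rk_def m_def using D by (intro card_mono) auto
    ultimately show ?thesis by simp
  qed
  have rk_less: "rk d < rk c" if cd: "c \<in> C" "d \<in> C" "c < d" for c d
  proof -
    have "{x \<in> C. d \<le> x} \<subseteq> {x \<in> C. c \<le> x}"
    proof (rule Collect_mono, rule impI)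
      fix x assume "x \<in> C \<and> d \<le> x"
      then show "x \<in> C \<and> c \<le> x" using order_trans[OF less_imp_le[OF cd(3)]] by simp
    qed
    moreover have "c \<in> {x \<in> C. c \<le> x}" "c \<notin> {x \<in> C. d \<le> x}"
      using cd by (simp_all add: less_le_not_le)
    ultimately have "{x \<in> C. d \<le> x} \<subset> {x \<in> C. c \<le> x}" by (metis psubsetI)
    then show ?thesis unfolding rk_def using D by (intro psubset_card_mono) auto
  qed
  have inj: "inj_on rk C"
  proof (rule inj_onI, rule ccontr)
    fix c d assume cd: "c \<in> C" "d \<in> C" "rk c = rk d" "c \<noteq> d"
    then have "c < d \<or> d < c" using total[of c d] by (auto simp: order_less_le)
    then show False using rk_less[OF cd(1,2)] rk_less[OF cd(2,1)] cd(3) by auto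
  qed
  have surj: "rk ` C = {1..m}"
    using rk_pos card_image[OF inj] by (intro card_subset_eq) (auto simp: m_def)
  \<comment> \<open>The members true at \<open>s\<close> form a final part of size
    \<open>u s\<close>, and \<open>c\<close> belongs to it iff the members above \<open>c\<close>
    are no more than that.\<close>
  have rank: "c s \<longleftrightarrow> rk c \<le> u s" if c: "c \<in> C" for c s
  proof
    assume "c s"
    then have "{d \<in> C. c \<le> d} \<subseteq> {d \<in> C. d s}" by (auto simp: le_fun_def)
    then show "rk c \<le> u s" unfolding rk_def u_def using D by (intro card_mono) auto
  next
    assume le: "rk c \<le> u s"
    show "c s"
    proof (rule ccontr)
      assume neg: "\<not> c s"
      have "{d \<in> C. d s} \<subset> {d \<in> C. c \<le> d}"
      proof
        show "{d \<in> C. d s} \<subseteq> {d \<in> C. c \<le> d}"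
        proof
          fix d assume d: "d \<in> {d \<in> C. d s}"
          then have "\<not> d \<le> c" using neg by (auto simp: le_fun_def)
          then show "d \<in> {d \<in> C. c \<le> d}" using total[OF c, of d] d by blast
        qed
        have "c \<in> {d \<in> C. c \<le> d}" "c \<notin> {d \<in> C. d s}" using c neg by auto
        then show "{d \<in> C. d s} \<noteq> {d \<in> C. c \<le> d}" by metis
      qed
      then have "u s < rk c" unfolding rk_def u_def using D by (intro psubset_card_mono) auto
      then show False using le by simp
    qed
  qed
  have a_rk: "a (rk c) = c" if c: "c \<in> C" for c
  proof
    fix s
    show "a (rk c) s = c s"
    proof (cases "s \<in> S")
      case True
      then show ?thesis
        using rank[OF c, of s] rk_pos[OF c] mn um[of s] by (auto simp: a_def h_def)
    next
      case False
      have "c \<in> S \<rightarrow>\<^sub>E UNIV" using c D(4) by blast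
      then show ?thesis using False by (simp add: a_def PiE_iff extensional_def)
    qed
  qed
  have a_big: "a i = a m" if "i \<in> {1..n}" "m \<le> i" for i
    using that um mn by (auto simp: a_def h_def fun_eq_iff restrict_def)
  have "a ` {1..n} = C"
  proof
    show "C \<subseteq> a ` {1..n}"
    proof
      fix c assume c: "c \<in> C"
      have "rk c \<in> {1..n}" using rk_pos[OF c] mn by simp
      then show "c \<in> a ` {1..n}" using a_rk[OF c] by (metis imageI)
    qed
    have am: "a i \<in> C" if i: "i \<in> {1..m}" for i
    proof -
      obtain c where "c \<in> C" "rk c = i" using surj i by (metis imageE)
      then show ?thesis using a_rk by metis
    qed
    show "a ` {1..n} \<subseteq> C"
    proof
      fix x assume "x \<in> a ` {1..n}"
      then obtain i where i: "i \<in> {1..n}" "x = a i" by blast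
      show "x \<in> C"
      proof (cases "i \<le> m")
        case True
        then show ?thesis using am[of i] i by simp
      next
        case False
        then have "x = a m" using a_big[OF i(1)] i(2) by simp
        then show ?thesis using am[of m] mn by simp
      qed
    qed
  qed
  moreover have "h \<in> S \<rightarrow>\<^sub>E {..n}"
    using mn um by (auto simp: h_def)
  ultimately show ?thesis using that[of h] by (simp add: level_chain_def a_def)
qed

text \<open>Each level \<open>a i\<close> is continuous from a power of a finite discrete space to
  the cube. The preimage of a box under \<open>level_chain\<close> is the intersection over the
  \<open>n\<close> levels of preimages of \<open>V\<close>, and that of a diamond is their union;
  both are open.\<close>

lemma compact_space_CC_n: "compact_space (otop (CC_n n (two_pow S)))"
proof (cases "n = 0")
  \<comment> \<open>Without thresholds \<open>level_chain\<close> does not map into the space, which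
    is empty for \<open>n = 0\<close>.\<close>
  case True
  then have "cube_chains n S = {}" by (auto simp: cube_chains_def)
  then show ?thesis
    using points_CC_n[of n S] by (simp add: compact_space_def)
next
  case False
  define Z :: "('a \<Rightarrow> nat) topology" where "Z = product_topology (\<lambda>_. discrete_topology {..n}) S"
  have Ztop: "topspace Z = S \<rightarrow>\<^sub>E {..n}" by (simp add: Z_def)
  define a where "a = (\<lambda>i (h :: 'a \<Rightarrow> nat). \<lambda>s\<in>S. i \<le> h s)"
  have lvl: "level_chain n S h = (\<lambda>i. a i h) ` {1..n}" for h by (simp add: level_chain_def a_def)
  have comp: "compact_space Z"
    unfolding Z_def by (auto simp: compact_space_product_topology compact_space_discrete_topology)
  have cont: "continuous_map Z (otop (two_pow S)) (a i)" for i
    unfolding two_pow_def ordered_space.simps continuous_map_componentwise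
  proof (intro conjI ballI)
    show "a i ` topspace Z \<subseteq> extensional S" by (auto simp: a_def)
    fix s assume s: "s \<in> S"
    have "continuous_map Z (discrete_topology {..n}) (\<lambda>h. h s)"
      unfolding Z_def by (rule continuous_map_product_projection[OF s])
    moreover have "continuous_map (discrete_topology {..n}) (discrete_topology UNIV) (\<lambda>k. i \<le> k)"
      by simp
    ultimately have "continuous_map Z (discrete_topology UNIV) ((\<lambda>k. i \<le> k) \<circ> (\<lambda>h. h s))"
      by (rule continuous_map_compose)
    then show "continuous_map Z (discrete_topology UNIV) (\<lambda>h. a i h s)"
      using s by (simp add: a_def o_def)
  qed
  have pre: "openin Z {h \<in> topspace Z. a i h \<in> V}" if "clopen_in (otop (two_pow S)) V" for V i
    using cont that openin_continuous_map_preimage unfolding clopen_in_def by blast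
  have "continuous_map Z (otop (CC_n n (two_pow S))) (level_chain n S)"
    unfolding CC_n_def ordered_space.simps continuous_map_in_subtopology CC_def
      continuous_on_generated_topo_iff
  proof (intro conjI allI impI)
    have lc: "level_chain n S h \<in> cube_chains n S" for h
      by (rule level_chain_in_cube_chains[OF False])
    have cl: "level_chain n S h \<in> closed_chains (two_pow S)" for h
      using lc cube_chains_closed_chains by blast
    have ne: "{1..n} \<noteq> {}" "finite {1..n}" using False by auto
    fix W
    assume "W \<in> {cc_box (two_pow S) V |V. clopen_in (otop (two_pow S)) V} \<union>
                {cc_diamond (two_pow S) V |V. clopen_in (otop (two_pow S)) V}"
    then obtain V where V: "clopen_in (otop (two_pow S)) V"
      and W: "W = cc_box (two_pow S) V \<or> W = cc_diamond (two_pow S) V" by blast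
    have "level_chain n S -` cc_box (two_pow S) V \<inter> topspace Z =
        (\<Inter>i\<in>{1..n}. {h \<in> topspace Z. a i h \<in> V})"
      using cl ne(1) by (auto simp: cc_box_def lvl image_subset_iff)
    moreover have "level_chain n S -` cc_diamond (two_pow S) V \<inter> topspace Z =
        (\<Union>i\<in>{1..n}. {h \<in> topspace Z. a i h \<in> V})"
      using cl by (auto simp: cc_diamond_def lvl)
    ultimately show "openin Z (level_chain n S -` W \<inter> topspace Z)"
      using W pre[OF V] ne by (auto intro!: openin_Inter openin_Union)
  next
    have "level_chain n S h \<in> points (CC_n n (two_pow S))" for h
      unfolding points_CC_n by (rule level_chain_in_cube_chains[OF False])
    then have *: "level_chain n S h \<in> {C \<in> closed_chains (two_pow S). depth (two_pow S) C \<le> enat n}" for h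
      by (simp add: CC_n_def)
    then show "level_chain n S \<in> topspace Z \<rightarrow> {C \<in> closed_chains (two_pow S). depth (two_pow S) C \<le> enat n}"
      by blast
    show "level_chain n S ` topspace Z \<subseteq> \<Union> ({cc_box (two_pow S) V |V. clopen_in (otop (two_pow S)) V} \<union>
          {cc_diamond (two_pow S) V |V. clopen_in (otop (two_pow S)) V})"
      using * points_CC[of "two_pow S"] unfolding CC_def ordered_space.simps topology_generated_by_topspace
      by blast
  qed
  then have "compactin (otop (CC_n n (two_pow S))) (level_chain n S ` topspace Z)"
    using comp by (intro image_compactin[of Z]) (simp_all add: compact_space_def)
  moreover have "level_chain n S ` topspace Z = cube_chains n S"
  proof
    show "level_chain n S ` topspace Z \<subseteq> cube_chains n S"
      using level_chain_in_cube_chains[OF False] by blast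
    show "cube_chains n S \<subseteq> level_chain n S ` topspace Z"
    proof
      fix C assume "C \<in> cube_chains n S"
      then show "C \<in> level_chain n S ` topspace Z"
        unfolding Ztop by (metis imageI level_chain_surj)
    qed
  qed
  ultimately show ?thesis by (simp add: compact_space_def points_CC_n)
qed

section \<open>The algebra of clopen upsets\<close>

text \<open>The lattice operations of a record are picked from its order by a choice operator. The
  locale evaluates them as set operations.\<close>

locale set_lattice =
  fixes F :: "'a set heyting" (structure) and P :: "'a set"
  assumes eq_set: "eq F = (=)" and le_set: "le F = (\<subseteq>)"
    and Int_carrier: "\<lbrakk>U \<in> carrier F; V \<in> carrier F\<rbrakk> \<Longrightarrow> U \<inter> V \<in> carrier F"
    and Un_carrier: "\<lbrakk>U \<in> carrier F; V \<in> carrier F\<rbrakk> \<Longrightarrow> U \<union> V \<in> carrier F"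
    and whole_carrier: "P \<in> carrier F" and empty_carrier: "{} \<in> carrier F"
    and carrier_subset: "U \<in> carrier F \<Longrightarrow> U \<subseteq> P"
begin

text \<open>The equivalence includes uniqueness, so that rewriting with it resolves the choice
  operator in the join.\<close>

lemma least_Un:
  assumes "U \<in> carrier F" "V \<in> carrier F"
  shows "least F W (Upper F {U, V}) \<longleftrightarrow> W = U \<union> V"
proof -
  have "Upper F {U, V} = {W \<in> carrier F. U \<union> V \<subseteq> W}"
    using assms by (auto simp: Upper_def le_set)
  then have "least F W (Upper F {U, V}) \<longleftrightarrow>
      W \<in> carrier F \<and> U \<union> V \<subseteq> W \<and> (\<forall>X\<in>carrier F. U \<union> V \<subseteq> X \<longrightarrow> W \<subseteq> X)"
    by (auto simp: least_def le_set)
  then show ?thesis using Un_carrier[OF assms] by blast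
qed

lemma greatest_Int:
  assumes "U \<in> carrier F" "V \<in> carrier F"
  shows "greatest F W (Lower F {U, V}) \<longleftrightarrow> W = U \<inter> V"
proof -
  have "Lower F {U, V} = {W \<in> carrier F. W \<subseteq> U \<inter> V}"
    using assms by (auto simp: Lower_def le_set)
  then have "greatest F W (Lower F {U, V}) \<longleftrightarrow>
      W \<in> carrier F \<and> W \<subseteq> U \<inter> V \<and> (\<forall>X\<in>carrier F. X \<subseteq> U \<inter> V \<longrightarrow> X \<subseteq> W)"
    by (auto simp: greatest_def le_set)
  then show ?thesis using Int_carrier[OF assms] by blast
qed

lemma join_set: "\<lbrakk>U \<in> carrier F; V \<in> carrier F\<rbrakk> \<Longrightarrow> U \<squnion> V = U \<union> V"
  by (simp add: join_def sup_def least_Un)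

lemma meet_set: "\<lbrakk>U \<in> carrier F; V \<in> carrier F\<rbrakk> \<Longrightarrow> U \<sqinter> V = U \<inter> V"
  by (simp add: meet_def inf_def greatest_Int)

lemma top_set: "\<top> = P"
proof -
  have "greatest F W (carrier F) \<longleftrightarrow> W = P" for W
    using whole_carrier carrier_subset unfolding greatest_def le_set by blast
  then show ?thesis by (simp add: top_def)
qed

lemma bottom_set: "\<bottom> = {}"
proof -
  have "least F W (carrier F) \<longleftrightarrow> W = {}" for W
    using empty_carrier unfolding least_def le_set by blast
  then show ?thesis by (simp add: bottom_def)
qed

lemma bounded_lattice_set: "Lattice.bounded_lattice F"
proof -
  interpret partial_order F
    by unfold_locales (auto simp: eq_set le_set)
  interpret lattice F
    by unfold_locales (auto simp: least_Un greatest_Int)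
  show ?thesis
  proof unfold_locales
    show "\<exists>x. least F x (carrier F)"
      using empty_carrier by (intro exI[of _ "{}"]) (simp add: least_def le_set)
    show "\<exists>x. greatest F x (carrier F)"
      using whole_carrier carrier_subset by (intro exI[of _ P]) (simp add: greatest_def le_set)
  qed
qed

end

lemma carrier_clopen_upsets_CC_n:
  "U \<in> carrier (clopen_upsets (CC_n n (two_pow S))) \<longleftrightarrow>
    clopen_in (otop (CC_n n (two_pow S))) U \<and> U \<subseteq> cube_chains n S \<and>
    (\<forall>C\<in>U. \<forall>K\<in>cube_chains n S. final_part C K \<longrightarrow> K \<in> U)"
proof -
  have "(\<forall>C\<in>U. \<forall>K\<in>cube_chains n S. ole (CC_n n (two_pow S)) C K \<longrightarrow> K \<in> U) \<longleftrightarrow>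
      (\<forall>C\<in>U. \<forall>K\<in>cube_chains n S. final_part C K \<longrightarrow> K \<in> U)" if "U \<subseteq> cube_chains n S"
    by (intro ball_cong refl) (simp add: ole_CC_n[OF subsetD[OF that]])
  then show ?thesis
    by (cases "U \<subseteq> cube_chains n S")
      (simp_all only: clopen_upsets_def partial_object.simps upset_of_def points_CC_n mem_Collect_eq simp_thms)
qed

text \<open>Compactness is used twice. For \<open>C\<close> in the upset \<open>U\<close>, no point
  outside \<open>U\<close> is a final part of \<open>C\<close>, so generated sets separate
  \<open>C\<close> from all such points; finitely many suffice, and their intersection is a
  generated set between \<open>C\<close> and \<open>U\<close>. Finitely many of these intermediate
  sets then cover \<open>U\<close>.\<close>

lemma clopen_upset_generated:
  assumes "U \<in> carrier (clopen_upsets (CC_n n (two_pow S)))"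
  shows "U \<in> generated n S"
proof -
  let ?T = "otop (CC_n n (two_pow S))"
  have clop: "clopen_in ?T U" and sub: "U \<subseteq> cube_chains n S"
    and up: "\<And>C K. \<lbrakk>C \<in> U; K \<in> cube_chains n S; final_part C K\<rbrakk> \<Longrightarrow> K \<in> U"
    using assms unfolding carrier_clopen_upsets_CC_n by metis+
  have comp: "compactin ?T U" "compactin ?T (cube_chains n S - U)"
    using clop compact_space_CC_n[of n S]
    by (auto simp: clopen_in_def closedin_compact_space closedin_def points_CC_n Diff_Diff_Int
        intro!: closedin_compact_space)
  have ex: "\<exists>W\<in>generated n S. C \<in> W \<and> W \<subseteq> U" if CU: "C \<in> U" for C
  proof -
    have C: "C \<in> cube_chains n S" using CU sub by blast
    define \<V> where "\<V> = {W \<in> generated n S. C \<in> W}"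
    have "\<forall>N\<in>(\<lambda>W. cube_chains n S - W) ` \<V>. openin ?T N"
      using generated_clopen[of _ n S] by (auto simp: \<V>_def clopen_in_def closedin_def points_CC_n)
    moreover have "cube_chains n S - U \<subseteq> \<Union> ((\<lambda>W. cube_chains n S - W) ` \<V>)"
    proof
      fix K assume K: "K \<in> cube_chains n S - U"
      then have "\<not> final_part C K" using up[OF CU] by blast
      then obtain W where "W \<in> generated n S" "C \<in> W" "K \<notin> W"
        using separate[OF C, of K] K by blast
      then show "K \<in> \<Union> ((\<lambda>W. cube_chains n S - W) ` \<V>)" using K by (auto simp: \<V>_def)
    qed
    ultimately obtain \<F> where F: "finite \<F>" "\<F> \<subseteq> (\<lambda>W. cube_chains n S - W) ` \<V>"
      "cube_chains n S - U \<subseteq> \<Union>\<F>"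
      using comp(2) unfolding compactin_def by metis
    obtain \<W> where W: "finite \<W>" "\<W> \<subseteq> \<V>" "\<F> = (\<lambda>W. cube_chains n S - W) ` \<W>"
      using finite_subset_image[OF F(1,2)] by metis
    have "cube_chains n S \<inter> \<Inter>\<W> \<in> generated n S"
      using W(1,2) by (intro generated_Inter) (auto simp: \<V>_def)
    moreover have "C \<in> cube_chains n S \<inter> \<Inter>\<W>" using C W(2) by (auto simp: \<V>_def)
    moreover have "cube_chains n S \<inter> \<Inter>\<W> \<subseteq> U" using F(3) unfolding W(3) by blast
    ultimately show ?thesis by metis
  qed
  define \<V> where "\<V> = {W \<in> generated n S. W \<subseteq> U}"
  have "\<forall>N\<in>\<V>. openin ?T N" using generated_clopen[of _ n S] by (auto simp: \<V>_def clopen_in_def)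
  moreover have "U \<subseteq> \<Union>\<V>" using ex by (auto simp: \<V>_def)
  ultimately obtain \<F> where F: "finite \<F>" "\<F> \<subseteq> \<V>" "U \<subseteq> \<Union>\<F>"
    using comp(1) unfolding compactin_def by metis
  then have "U = \<Union>\<F>" by (auto simp: \<V>_def)
  moreover have "\<Union>\<F> \<in> generated n S" using F by (intro generated_Union) (auto simp: \<V>_def)
  ultimately show ?thesis by simp
qed

lemma clopen_upsets_eq_generated:
  "carrier (clopen_upsets (CC_n n (two_pow S))) = generated n S"
proof (intro equalityI subsetI)
  fix U assume U: "U \<in> generated n S"
  have "\<forall>C\<in>U. \<forall>K\<in>cube_chains n S. final_part C K \<longrightarrow> K \<in> U"
    using generated_upset[OF U] by metis
  then show "U \<in> carrier (clopen_upsets (CC_n n (two_pow S)))"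
    unfolding carrier_clopen_upsets_CC_n
    using generated_clopen[OF U] generated_subset[OF U] by metis
qed (rule clopen_upset_generated)

lemma set_lattice_clopen_upsets:
  "set_lattice (clopen_upsets (CC_n n (two_pow S))) (cube_chains n S)"
  by unfold_locales
    (simp_all only: clopen_upsets_eq_generated generated.intros generated_subset,
     simp_all add: clopen_upsets_def)

section \<open>Residuation, prelinearity and bounded depth for clopen upsets\<close>

lemma final_parts_linear:
  assumes C: "C \<in> cube_chains n S" and K: "final_part C K" and L: "final_part C L"
  shows "final_part K L \<or> final_part L K"
proof -
  have "K \<subseteq> L \<or> L \<subseteq> K"
  proof (rule ccontr)
    assume "\<not> (K \<subseteq> L \<or> L \<subseteq> K)"
    \<comment> \<open>The greater of \<open>x\<close> and \<open>y\<close> must lie in both final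
      parts.\<close>
    then obtain x y where xy: "x \<in> K" "x \<notin> L" "y \<in> L" "y \<notin> K" unfolding subset_iff by metis
    have c: "x \<in> C" "y \<in> C" using xy final_partD1 K L by blast+
    then consider "x \<le> y" | "y \<le> x" using cube_chain_total[OF C] by metis
    then show False
      by cases (use final_partD2[OF K xy(1) c(2)] final_partD2[OF L xy(3) c(1)] xy in metis)+
  qed
  moreover have "final_part B A" if "A \<subseteq> B" "final_part C A" "final_part C B" for A B
    using that(1) final_partD2[OF that(2)] final_partD1[OF that(3)]
    by (intro final_partI) auto
  ultimately show ?thesis using K L by metis
qed

lemma himp_generated:
  "U \<in> generated n S \<Longrightarrow> himp (clopen_upsets (CC_n n (two_pow S))) U V = chain_imp n S U V"
  by (rule himp_clopen_upsets[OF generated_subset])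

lemma GA_algebra_clopen_upsets: "GA_algebra n (clopen_upsets (CC_n n (two_pow S)))"
proof -
  let ?F = "clopen_upsets (CC_n n (two_pow S))"
  let ?P = "cube_chains n S"
  interpret L: set_lattice ?F ?P by (rule set_lattice_clopen_upsets)
  interpret B: Lattice.bounded_lattice ?F by (rule L.bounded_lattice_set)
  note car = clopen_upsets_eq_generated[of n S]
  have res: "U \<inter> V \<subseteq> W \<longleftrightarrow> U \<subseteq> chain_imp n S V W"
    if U: "U \<in> generated n S" and V: "V \<in> generated n S" for U V W
  proof
    assume UVW: "U \<inter> V \<subseteq> W"
    show "U \<subseteq> chain_imp n S V W"
    proof
      fix C assume C: "C \<in> U"
      show "C \<in> chain_imp n S V W"
      proof (rule chain_impI)
        show "C \<in> ?P" using C generated_subset[OF U] by blast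
        fix K assume "K \<in> ?P" "final_part C K" "K \<in> V"
        then show "K \<in> W" using generated_upset[OF U C, of K] UVW by blast
      qed
    qed
  next
    assume sub: "U \<subseteq> chain_imp n S V W"
    show "U \<inter> V \<subseteq> W"
    proof
      fix C assume C: "C \<in> U \<inter> V"
      show "C \<in> W"
        by (rule chain_impD[of C n S V W C])
          (use C sub generated_subset[OF U] final_part_refl in auto)
    qed
  qed
  interpret H: heyting_algebra ?F
  proof
    fix U V assume "U \<in> carrier ?F" "V \<in> carrier ?F"
    then show "himp ?F U V \<in> carrier ?F"
      unfolding car by (simp only: himp_generated generated.imp)
  next
    fix U V W assume c: "U \<in> carrier ?F" "V \<in> carrier ?F" "W \<in> carrier ?F"
    show "(le ?F (meet ?F U V) W) \<longleftrightarrow> (le ?F U (himp ?F V W))"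
      using res[of U V W] c himp_generated[of V n S W] unfolding L.meet_set[OF c(1,2)] L.le_set car
      by simp
  qed
  interpret G: goedel_algebra ?F
  proof
    fix U V assume c: "U \<in> carrier ?F" "V \<in> carrier ?F"
    then have g: "U \<in> generated n S" "V \<in> generated n S" by (simp_all only: car)
    have "C \<in> chain_imp n S U V \<union> chain_imp n S V U" if C: "C \<in> ?P" for C
    proof (rule ccontr)
      assume neg: "C \<notin> chain_imp n S U V \<union> chain_imp n S V U"
      obtain K where K: "K \<in> ?P" "final_part C K" "K \<in> U" "K \<notin> V"
        using neg chain_impI[OF C, of U V] by auto
      obtain L where L: "L \<in> ?P" "final_part C L" "L \<in> V" "L \<notin> U"
        using neg chain_impI[OF C, of V U] by auto
      \<comment> \<open>Whichever of \<open>K\<close> and \<open>L\<close> is a final part of the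
        other lies in both \<open>U\<close> and \<open>V\<close>.\<close>
      show False
        using final_parts_linear[OF C K(2) L(2)] generated_upset[OF g(1) K(3) L(1)]
          generated_upset[OF g(2) L(3) K(1)] K L by metis
    qed
    then have "chain_imp n S U V \<union> chain_imp n S V U = ?P"
      unfolding chain_imp_def by blast
    then show "join ?F (himp ?F U V) (himp ?F V U) = top ?F"
      using L.join_set[OF H.himp_closed[OF c] H.himp_closed[OF c(2,1)]]
      by (simp add: himp_generated[OF g(1)] himp_generated[OF g(2)] L.top_set)
  qed
  \<comment> \<open>If \<open>C\<close> is not in \<open>x (Suc k)\<close>, any final part of
    \<open>C\<close> that is in it is proper, so it has at most \<open>k\<close> members and
    induction applies. At stage 0 there is no chain, chains being nonempty.\<close>
  have bd: "C \<in> bd ?F x k"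
    if x: "\<And>i. x i \<in> carrier ?F" and C: "C \<in> ?P" "card C \<le> k" for x C k
    using C
  proof (induction k arbitrary: C)
    case 0
    then show ?case using cube_chainsD(1,2)[OF 0(1)] by simp
  next
    case (Suc k)
    note bc = H.bd_closed[of x k, OF x]
    have x': "x (Suc k) \<in> generated n S" using x by (simp only: car)
    have "C \<in> chain_imp n S (x (Suc k)) (bd ?F x k)" if Cx: "C \<notin> x (Suc k)"
    proof (rule chain_impI[OF Suc.prems(1)])
      fix K assume K: "K \<in> ?P" "final_part C K" "K \<in> x (Suc k)"
      then have "K \<subset> C" using Cx final_partD1[OF K(2)] by blast
      then have "card K < card C" using cube_chainsD(2)[OF Suc.prems(1)] by (rule psubset_card_mono[rotated])
      then show "K \<in> bd ?F x k" using K(1) Suc.prems(2) by (intro Suc.IH) auto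
    qed
    then show ?case
      using L.join_set[OF x H.himp_closed[OF x bc], of "Suc k" "Suc k"] himp_generated[OF x'] by auto
  qed
  show ?thesis
  proof
    fix x :: "nat \<Rightarrow> ('a \<Rightarrow> bool) set set" assume x: "\<And>i. x i \<in> carrier ?F"
    have "?P \<subseteq> bd ?F x n" using bd[of x, OF x] cube_chainsD(3)[of _ n S] by blast
    then show "bd ?F x n = top ?F"
      using L.carrier_subset[OF H.bd_closed[of x n, OF x]] by (simp add: L.top_set)
  qed
qed

section \<open>From prime filters to chains: extending an assignment\<close>

locale goedel_assignment = GA_algebra n H for n and H :: "'h heyting" (structure) +
  fixes S :: "'i set" and f :: "'i \<Rightarrow> 'h"
  assumes assignment: "f \<in> S \<rightarrow> carrier H"
begin

definition trace :: "'h set \<Rightarrow> 'i \<Rightarrow> bool" where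
  "trace q = (\<lambda>s\<in>S. f s \<in> q)"

text \<open>This map is dual to the homomorphism being built. Distinct filters above
  \<open>p\<close> may share a trace, so the chain can have fewer members than there are
  filters.\<close>

definition prime_chain :: "'h set \<Rightarrow> ('i \<Rightarrow> bool) set" where
  "prime_chain p = trace ` primes_above H p"

lemma trace_mono: "q \<subseteq> r \<Longrightarrow> trace q \<le> trace r"
  by (auto simp: trace_def le_fun_def restrict_def)

lemma prime_chain_in_cube_chains:
  assumes p: "prime_filter H p"
  shows "prime_chain p \<in> cube_chains n S"
proof -
  note fin = primes_above_card[OF p]
  have "card (prime_chain p) \<le> n"
    unfolding prime_chain_def using fin card_image_le order_trans by metis
  moreover have "finite (prime_chain p)" unfolding prime_chain_def using fin by blast
  moreover have "prime_chain p \<noteq> {}" using p by (auto simp: prime_chain_def primes_above_def)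
  moreover have "prime_chain p \<subseteq> S \<rightarrow>\<^sub>E UNIV" by (auto simp: prime_chain_def trace_def)
  moreover have "x \<le> y \<or> y \<le> x" if xy: "x \<in> prime_chain p" "y \<in> prime_chain p" for x y
  proof -
    obtain q r where "q \<in> primes_above H p" "r \<in> primes_above H p" "x = trace q" "y = trace r"
      using xy unfolding prime_chain_def by blast
    then show ?thesis using primes_above_chain[OF p, of q r] trace_mono by metis
  qed
  ultimately show ?thesis by (simp add: cube_chains_def)
qed

text \<open>The filters above \<open>p\<close> form a chain, so a filter \<open>t\<close> not
  containing \<open>q\<close> lies inside every filter above \<open>q\<close>; its trace can lie
  above one of their traces only by being equal to it.\<close>

lemma prime_chain_final:
  assumes p: "prime_filter H p" and q: "q \<in> primes_above H p"
  shows "final_part (prime_chain p) (prime_chain q)"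
proof (rule final_partI)
  have "primes_above H q \<subseteq> primes_above H p" using q by (auto simp: primes_above_def)
  then show "prime_chain q \<subseteq> prime_chain p" unfolding prime_chain_def by (rule image_mono)
  fix x y assume x: "x \<in> prime_chain q" and y: "y \<in> prime_chain p" and le: "x \<le> y"
  obtain r where r: "r \<in> primes_above H q" "x = trace r"
    using x unfolding prime_chain_def by blast
  obtain t where t: "t \<in> primes_above H p" "y = trace t"
    using y unfolding prime_chain_def by blast
  show "y \<in> prime_chain q"
  proof (cases "q \<subseteq> t")
    case True
    then have "t \<in> primes_above H q" using t(1) by (simp add: primes_above_def)
    then show ?thesis using t(2) by (simp add: prime_chain_def)
  next
    case False
    then have "t \<subseteq> r" using primes_above_chain[OF p q t(1)] r(1) by (auto simp: primes_above_def)
    then have "x = y" using trace_mono[of t r] le r(2) t(2) by simp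
    then show ?thesis using x by simp
  qed
qed

text \<open>The back condition of a p-morphism. Take for \<open>q\<close> the least filter above
  \<open>p\<close> whose trace lies in \<open>K\<close>: minimality gives one inclusion, and
  monotonicity of traces together with finality of \<open>K\<close> gives the other.\<close>

lemma final_part_prime_chain:
  assumes p: "prime_filter H p" and K: "final_part (prime_chain p) K" "K \<noteq> {}"
  obtains q where "q \<in> primes_above H p" "K = prime_chain q"
proof -
  define R where "R = {q \<in> primes_above H p. trace q \<in> K}"
  have "finite R" using primes_above_card[OF p] by (simp add: R_def)
  moreover have "R \<noteq> {}"
    using K(2) final_partD1[OF K(1)] by (auto simp: R_def prime_chain_def)
  ultimately obtain q where q: "q \<in> R" "\<forall>r\<in>R. r \<subseteq> q \<longrightarrow> q = r"
    using finite_has_minimal[of R] by metis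
  have qp: "q \<in> primes_above H p" "trace q \<in> K" using q(1) by (simp_all add: R_def)
  have "K = prime_chain q"
  proof (intro equalityI subsetI)
    fix x assume x: "x \<in> K"
    then obtain r where r: "r \<in> primes_above H p" "x = trace r"
      using final_partD1[OF K(1)] unfolding prime_chain_def by blast
    then have "r \<in> R" using x by (simp add: R_def)
    then have "q \<subseteq> r" using primes_above_chain[OF p qp(1) r(1)] q(2) by auto
    then have "r \<in> primes_above H q" using r(1) by (simp add: primes_above_def)
    then show "x \<in> prime_chain q" using r(2) by (simp add: prime_chain_def)
  next
    fix x assume "x \<in> prime_chain q"
    then obtain r where r: "r \<in> primes_above H q" "x = trace r"
      unfolding prime_chain_def by blast
    then have "r \<in> primes_above H p" "q \<subseteq> r" using qp(1) by (auto simp: primes_above_def)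
    then have "x \<in> prime_chain p" "trace q \<le> x" using r(2) trace_mono by (simp_all add: prime_chain_def)
    then show "x \<in> K" by (rule final_partD2[OF K(1) qp(2)])
  qed
  then show ?thesis using that qp(1) by metis
qed

text \<open>The preimage of \<open>U\<close> under \<open>prime_chain\<close> is the Stone set of
  \<open>h\<close>.\<close>

definition represents :: "('i \<Rightarrow> bool) set set \<Rightarrow> 'h \<Rightarrow> bool" where
  "represents U h \<longleftrightarrow> h \<in> carrier H \<and> (\<forall>p. prime_filter H p \<longrightarrow> (prime_chain p \<in> U \<longleftrightarrow> h \<in> p))"

lemma represents_unique: "\<lbrakk>represents U h; represents U k\<rbrakk> \<Longrightarrow> h = k"
  by (rule eq_if_primes) (simp_all add: represents_def)

lemma represents_gen:
  assumes s: "s \<in> S"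
  shows "represents (gen_map n S s) (f s)"
proof -
  have "prime_chain p \<in> gen_map n S s \<longleftrightarrow> f s \<in> p" if p: "prime_filter H p" for p
  proof -
    have "prime_chain p \<in> gen_map n S s \<longleftrightarrow> (\<forall>q\<in>primes_above H p. f s \<in> q)"
      unfolding gen_map_eq[OF s] using prime_chain_in_cube_chains[OF p] s
      by (simp add: prime_chain_def trace_def)
    also have "\<dots> \<longleftrightarrow> f s \<in> p" using p by (auto simp: primes_above_def)
    finally show ?thesis .
  qed
  then show ?thesis using assignment s by (auto simp: represents_def)
qed

lemma represents_empty: "represents {} \<bottom>"
  by (simp add: represents_def prime_filter_def)

lemma represents_whole: "represents (cube_chains n S) \<top>"
  using prime_chain_in_cube_chains by (simp add: represents_def prime_filter_def lattice_filter_def)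

lemma represents_Int:
  "\<lbrakk>represents U h; represents V k\<rbrakk> \<Longrightarrow> represents (U \<inter> V) (h \<sqinter> k)"
  unfolding represents_def using filter_meet_iff[OF prime_filter_imp_filter] by simp

lemma represents_Un:
  "\<lbrakk>represents U h; represents V k\<rbrakk> \<Longrightarrow> represents (U \<union> V) (h \<squnion> k)"
  unfolding represents_def using prime_join_iff by simp

text \<open>Both implications quantify over successors. Filters above \<open>p\<close> yield final
  parts of \<open>prime_chain p\<close>, and the back condition shows that every nonempty final part
  arises in this way.\<close>

lemma represents_imp:
  assumes U: "represents U h" and V: "represents V k"
  shows "represents (chain_imp n S U V) (h \<rightharpoonup> k)"
proof -
  have c: "h \<in> carrier H" "k \<in> carrier H" using U V by (simp_all add: represents_def)
  have "prime_chain p \<in> chain_imp n S U V \<longleftrightarrow> h \<rightharpoonup> k \<in> p" if p: "prime_filter H p" for p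
  proof -
    have rep: "prime_chain q \<in> U \<longleftrightarrow> h \<in> q" "prime_chain q \<in> V \<longleftrightarrow> k \<in> q"
      if "q \<in> primes_above H p" for q
      using that U V by (simp_all add: represents_def primes_above_def)
    have "prime_chain p \<in> chain_imp n S U V \<longleftrightarrow> (\<forall>q\<in>primes_above H p. h \<in> q \<longrightarrow> k \<in> q)"
    proof
      assume A: "prime_chain p \<in> chain_imp n S U V"
      show "\<forall>q\<in>primes_above H p. h \<in> q \<longrightarrow> k \<in> q"
      proof (intro ballI impI)
        fix q assume q: "q \<in> primes_above H p" "h \<in> q"
        then have "prime_chain q \<in> cube_chains n S"
          by (intro prime_chain_in_cube_chains) (simp add: primes_above_def)
        then have "prime_chain q \<in> V"
          using chain_impD[OF A _ prime_chain_final[OF p q(1)]] rep(1)[OF q(1)] q(2) by metis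
        then show "k \<in> q" using rep(2)[OF q(1)] by metis
      qed
    next
      assume A: "\<forall>q\<in>primes_above H p. h \<in> q \<longrightarrow> k \<in> q"
      show "prime_chain p \<in> chain_imp n S U V"
      proof (rule chain_impI[OF prime_chain_in_cube_chains[OF p]])
        fix K assume K: "K \<in> cube_chains n S" "final_part (prime_chain p) K" "K \<in> U"
        obtain q where "q \<in> primes_above H p" "K = prime_chain q"
          using final_part_prime_chain[OF p K(2) cube_chainsD(1)[OF K(1)]] .
        then show "K \<in> V" using rep A K(3) by metis
      qed
    qed
    then show ?thesis using prime_himp_iff[OF p c] by simp
  qed
  then show ?thesis using himp_closed[OF c] by (simp add: represents_def)
qed

lemma represents_ex: "U \<in> generated n S \<Longrightarrow> \<exists>h. represents U h"
proof (induction rule: generated.induct)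
  case (gen s)
  show ?case using represents_gen[OF gen] by metis
next
  case empty
  show ?case using represents_empty by metis
next
  case whole
  show ?case using represents_whole by metis
next
  case (Int U V)
  then show ?case using represents_Int by metis
next
  case (Un U V)
  then show ?case using represents_Un by metis
next
  case (imp U V)
  then show ?case using represents_imp by metis
qed

text \<open>Restricted to the carrier, because uniqueness of a total function can only be claimed
  among extensional ones.\<close>

definition extension :: "('i \<Rightarrow> bool) set set \<Rightarrow> 'h" where
  "extension = (\<lambda>U\<in>generated n S. THE h. represents U h)"

lemma extension_eqI: "\<lbrakk>U \<in> generated n S; represents U h\<rbrakk> \<Longrightarrow> extension U = h"
  unfolding extension_def by (simp, rule the_equality) (auto intro: represents_unique)

lemma represents_extension: "U \<in> generated n S \<Longrightarrow> represents U (extension U)"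
  using represents_ex extension_eqI by metis

lemma extension_hom: "extension \<in> heyting_hom (clopen_upsets (CC_n n (two_pow S))) H"
proof -
  let ?F = "clopen_upsets (CC_n n (two_pow S))"
  interpret L: set_lattice ?F "cube_chains n S" by (rule set_lattice_clopen_upsets)
  note car = clopen_upsets_eq_generated[of n S]
  have "extension \<in> generated n S \<rightarrow> carrier H"
    using represents_extension by (auto simp: represents_def)
  moreover have "extension (meet ?F U V) = extension U \<sqinter> extension V \<and>
      extension (join ?F U V) = extension U \<squnion> extension V \<and>
      extension (himp ?F U V) = (extension U \<rightharpoonup> extension V)"
    if UV: "U \<in> generated n S" "V \<in> generated n S" for U V
  proof -
    note r = represents_extension[OF UV(1)] represents_extension[OF UV(2)]
    have "meet ?F U V = U \<inter> V" "join ?F U V = U \<union> V" "himp ?F U V = chain_imp n S U V"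
      using UV by (simp_all add: car L.meet_set L.join_set himp_generated)
    then show ?thesis
      using extension_eqI[OF generated.Int[OF UV] represents_Int[OF r]]
        extension_eqI[OF generated.Un[OF UV] represents_Un[OF r]]
        extension_eqI[OF generated.imp[OF UV] represents_imp[OF r]] by simp
  qed
  moreover have "extension (bottom ?F) = \<bottom>" "extension (top ?F) = \<top>"
    unfolding L.bottom_set L.top_set
    by (rule extension_eqI[OF generated.empty represents_empty]
        extension_eqI[OF generated.whole represents_whole])+
  ultimately show ?thesis unfolding heyting_hom_def car by simp
qed

end

section \<open>Uniqueness and the universal property\<close>

lemma heyting_hom_eq_on_generated:
  fixes H :: "'h heyting"
  assumes g: "g \<in> heyting_hom (clopen_upsets (CC_n n (two_pow S))) H"
    and g': "g' \<in> heyting_hom (clopen_upsets (CC_n n (two_pow S))) H"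
    and gens: "\<And>s. s \<in> S \<Longrightarrow> g (gen_map n S s) = g' (gen_map n S s)"
    and U: "U \<in> generated n S"
  shows "g U = g' U"
proof -
  let ?F = "clopen_upsets (CC_n n (two_pow S))"
  interpret L: set_lattice ?F "cube_chains n S" by (rule set_lattice_clopen_upsets)
  note car = clopen_upsets_eq_generated[of n S]
  have hom: "k (U \<inter> V) = k U \<sqinter>\<^bsub>H\<^esub> k V \<and> k (U \<union> V) = k U \<squnion>\<^bsub>H\<^esub> k V \<and>
      k (chain_imp n S U V) = (k U \<rightharpoonup>\<^bsub>H\<^esub> k V)"
    if k: "k \<in> heyting_hom ?F H" and UV: "U \<in> generated n S" "V \<in> generated n S" for k U V
  proof -
    have "meet ?F U V = U \<inter> V" "join ?F U V = U \<union> V" "himp ?F U V = chain_imp n S U V"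
      using UV by (simp_all add: car L.meet_set L.join_set himp_generated)
    moreover have "k (meet ?F U V) = k U \<sqinter>\<^bsub>H\<^esub> k V \<and> k (join ?F U V) = k U \<squnion>\<^bsub>H\<^esub> k V \<and>
        k (himp ?F U V) = (k U \<rightharpoonup>\<^bsub>H\<^esub> k V)"
      using k UV unfolding heyting_hom_def car by blast
    ultimately show ?thesis by metis
  qed
  have bounds: "k {} = \<bottom>\<^bsub>H\<^esub> \<and> k (cube_chains n S) = \<top>\<^bsub>H\<^esub>" if "k \<in> heyting_hom ?F H" for k
    using that unfolding heyting_hom_def L.bottom_set L.top_set by simp
  show ?thesis
    using U
  proof (induction rule: generated.induct)
    case (gen s)
    then show ?case by (rule gens)
  qed (simp_all add: hom[OF g] hom[OF g'] bounds[OF g] bounds[OF g'])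
qed

theorem theorem3p27:
  fixes n :: nat and S :: "'i set"
  defines "F \<equiv> clopen_upsets (CC_n n (two_pow S))"
  shows "GA_algebra n F \<and>
    gen_map n S \<in> S \<rightarrow> carrier F \<and>
    (\<forall>(H :: 'h heyting) f. GA_algebra n H \<and> f \<in> S \<rightarrow> carrier H \<longrightarrow>
       (\<exists>!g. g \<in> heyting_hom F H \<and> g \<in> extensional (carrier F) \<and>
             (\<forall>s\<in>S. g (gen_map n S s) = f s)))"
proof (intro conjI allI impI)
  have car: "carrier F = generated n S" unfolding F_def by (rule clopen_upsets_eq_generated)
  show "GA_algebra n F" unfolding F_def by (rule GA_algebra_clopen_upsets)
  show "gen_map n S \<in> S \<rightarrow> carrier F" unfolding car by (blast intro: generated.gen)
  fix H :: "'h heyting" and f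
  assume Hf: "GA_algebra n H \<and> f \<in> S \<rightarrow> carrier H"
  interpret goedel_assignment n H S f
    using Hf by (simp add: goedel_assignment_def goedel_assignment_axioms_def)
  show "\<exists>!g. g \<in> heyting_hom F H \<and> g \<in> extensional (carrier F) \<and> (\<forall>s\<in>S. g (gen_map n S s) = f s)"
  proof (rule ex1I[of _ extension])
    show "extension \<in> heyting_hom F H \<and> extension \<in> extensional (carrier F) \<and>
        (\<forall>s\<in>S. extension (gen_map n S s) = f s)"
      using extension_hom extension_eqI[OF generated.gen represents_gen]
      unfolding car unfolding F_def by (simp add: extension_def)
  next
    fix g assume g: "g \<in> heyting_hom F H \<and> g \<in> extensional (carrier F) \<and>
        (\<forall>s\<in>S. g (gen_map n S s) = f s)"
    show "g = extension"
    proof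
      fix U
      show "g U = extension U"
      proof (cases "U \<in> generated n S")
        case True
        then show ?thesis
          using g heyting_hom_eq_on_generated[OF _ extension_hom, of g U]
            extension_eqI[OF generated.gen represents_gen] unfolding F_def by simp
      next
        case False
        \<comment> \<open>Outside the carrier both functions are \<open>undefined\<close>.\<close>
        then show ?thesis
          using g unfolding car by (simp add: extension_def extensional_def)
      qed
    qed
  qed
qed

end
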